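(* For every integer $n\ge 2$, every $\varepsilon>0$, and every $R>0$, there exist a function $F:\mathbb{R}^n\to\mathbb{R}$ and a point $x_0\in\mathbb{R}^n$ with the following properties: (i) $F\in C^\infty(\mathbb{R}^n)$ is globally strongly convex, $$F-Q\in C_c^\infty(\mathbb{R}^n),\qquad \operatorname{supp}(F-Q)\cup\{x_0\}\subset B(0,R),$$ and $$\sup_{x\in\mathbb{R}^n}\lVert\nabla^2F(x)-I_n\rVert_{\mathrm{op}}<\varepsilon.$$ The unique minimizer of $F$ is $x_\star=0$, and $\nabla^2F(0)=I_n$. (ii) BFGS with exact line search applied to $F$, started from $x_0$ and initialized with $B_0=I_n$, is well defined. Every Hessian approximation $B_k$ is positive definite, the method does not terminate finitely, and its iterates $x_k$ converge to $0$. (iii) The iterates converge Q-superlinearly, i.e. $\lVert x_{k+1}\rVert/\lVert x_k\rVert\to 0$, while the Q-order of $\{x_k\}_{k\ge0}$ at the origin equals one. Consequently, among all nonterminating exact-line-search BFGS sequences that converge to a nondegenerate minimizer of a $C^\infty$ strongly convex objective, the smallest possible Q-order is one: every such sequence has a Q-order that is at least one, and the value one is attained (by the sequence above).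
   Context: Notation: $\lVert\cdot\rVert$ is the Euclidean norm on $\mathbb{R}^n$, $\lVert\cdot\rVert_{\mathrm{op}}$ the induced operator norm, $I_n$ the $n\times n$ identity matrix, $B(x,r)$ the open Euclidean ball, $Q(x):=\frac12\lVert x\rVert^2$ the standard quadratic on $\mathbb{R}^n$, $\operatorname{supp}$ the support, and $C_c^\infty(\mathbb{R}^n)$ the smooth compactly supported functions. A minimizer $x_\star$ is nondegenerate if $\nabla^2F(x_\star)$ is positive definite. BFGS with exact line search (Hessian form): given an iterate $x_k$ with gradient $g_k:=\nabla F(x_k)$ and a symmetric positive definite matrix $B_k$, the search direction $d_k$ is defined by $B_kd_k=-g_k$; an exact line search chooses $\alpha_k\in\arg\min_{\alpha\ge0}F(x_k+\alpha d_k)$ and sets $x_{k+1}=x_k+\alpha_kd_k$. With $s_k:=x_{k+1}-x_k$ and $y_k:=g_{k+1}-g_k$, the update is $$B_{k+1}=B_k-\frac{B_ks_ks_k^{\mathsf T}B_k}{s_k^{\mathsf T}B_ks_k}+\frac{y_ky_k^{\mathsf T}}{s_k^{\mathsf T}y_k},$$ which is well defined and preserves positive definiteness when $s_k^{\mathsf T}y_k>0$. The method terminates finitely if $\nabla F(x_k)=0$ for some $k$; otherwise the run is nonterminating. Q-order: let $x_k\to x_\star$ with $x_k\ne x_\star$ for all sufficiently large $k$. For $p\ge1$ the sequence has Q-order at least $p$ at $x_\star$ if there exist $C>0$ and $k_0$ such that $\lVert x_{k+1}-x_\star\rVert\le C\lVert x_k-x_\star\rVert^p$ for all $k\ge k_0$.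 Whenever the set of admissible exponents is nonempty, the Q-order of $\{x_k\}$ at $x_\star$ is $\sup\{p\ge1:\{x_k\}\text{ has Q-order at least }p\text{ at }x_\star\}$. *)

theory Defs
  imports "HOL-Analysis.Analysis"
begin

subsection \<open>Smooth functions, gradient and Hessian\<close>

text \<open>\<open>k\<close> times continuously differentiable on the whole space; for differentiable functions the
  derivative is continuous iff all directional derivatives are.\<close>

primrec C_diff :: "nat \<Rightarrow> ('a::euclidean_space \<Rightarrow> real) \<Rightarrow> bool" where
  "C_diff 0 f \<longleftrightarrow> continuous_on UNIV f"
| "C_diff (Suc k) f \<longleftrightarrow>
     f differentiable_on UNIV \<and> (\<forall>v. C_diff k (\<lambda>x. frechet_derivative f (at x) v))"

definition smooth :: "('a::euclidean_space \<Rightarrow> real) \<Rightarrow> bool" where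
  "smooth f \<longleftrightarrow> (\<forall>k. C_diff k f)"

definition supp :: "('a::euclidean_space \<Rightarrow> real) \<Rightarrow> 'a set" where
  "supp f = closure (support_on UNIV f)"

definition smooth_compact_supp :: "('a::euclidean_space \<Rightarrow> real) \<Rightarrow> bool" where
  "smooth_compact_supp f \<longleftrightarrow> smooth f \<and> compact (supp f)"

definition grad :: "(real^'n \<Rightarrow> real) \<Rightarrow> real^'n \<Rightarrow> real^'n" where
  "grad f x = (\<chi> i. frechet_derivative f (at x) (axis i 1))"

definition hessian :: "(real^'n \<Rightarrow> real) \<Rightarrow> real^'n \<Rightarrow> real^'n^'n" where
  "hessian f x = jacobian (grad f) (at x)"

definition strongly_convex :: "('a::euclidean_space \<Rightarrow> real) \<Rightarrow> bool" where
  "strongly_convex f \<longleftrightarrow> (\<exists>m>0. \<forall>x y. \<forall>t\<in>{0..1}.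
     f ((1 - t) *\<^sub>R x + t *\<^sub>R y)
       \<le> (1 - t) * f x + t * f y - m / 2 * t * (1 - t) * (norm (x - y))\<^sup>2)"

definition std_quad :: "'a::euclidean_space \<Rightarrow> real" where
  "std_quad x = (norm x)\<^sup>2 / 2"

definition minimizer :: "('a \<Rightarrow> real) \<Rightarrow> 'a \<Rightarrow> bool" where
  "minimizer f z \<longleftrightarrow> is_arg_min f (\<lambda>_. True) z"


subsection \<open>Matrices\<close>

definition pos_def :: "real^'n^'n \<Rightarrow> bool" where
  "pos_def A \<longleftrightarrow> (\<forall>v. v \<noteq> 0 \<longrightarrow> 0 < v \<bullet> (A *v v))"

definition sym_pos_def :: "real^'n^'n \<Rightarrow> bool" where
  "sym_pos_def A \<longleftrightarrow> transpose A = A \<and> pos_def A"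

definition outer :: "real^'n \<Rightarrow> real^'n \<Rightarrow> real^'n^'n" where
  "outer u v = (\<chi> i j. u $ i * v $ j)"

abbreviation op_norm :: "real^'n^'n \<Rightarrow> real" where
  "op_norm A \<equiv> onorm ((*v) A)"


subsection \<open>BFGS with exact line search\<close>

definition bfgs_update :: "real^'n^'n \<Rightarrow> real^'n \<Rightarrow> real^'n \<Rightarrow> real^'n^'n" where
  "bfgs_update B s y =
     B - (B ** outer s s ** B) /\<^sub>R (s \<bullet> (B *v s)) + outer y y /\<^sub>R (s \<bullet> y)"

definition exact_line_search :: "('a::real_vector \<Rightarrow> real) \<Rightarrow> 'a \<Rightarrow> 'a \<Rightarrow> real \<Rightarrow> bool" where
  "exact_line_search F x d \<alpha> \<longleftrightarrow> is_arg_min (\<lambda>t. F (x + t *\<^sub>R d)) (\<lambda>t. 0 \<le> t) \<alpha>"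

definition bfgs_step ::
  "(real^'n \<Rightarrow> real) \<Rightarrow> real^'n \<Rightarrow> real^'n^'n \<Rightarrow> real^'n \<Rightarrow> real^'n^'n \<Rightarrow> bool" where
  "bfgs_step F x B x' B' \<longleftrightarrow>
     (\<exists>d \<alpha>. B *v d = - grad F x \<and> exact_line_search F x d \<alpha> \<and> x' = x + \<alpha> *\<^sub>R d) \<and>
     B' = bfgs_update B (x' - x) (grad F x' - grad F x)"

text \<open>A run is an infinite sequence. If the gradient vanishes at some iterate, the sequences may
  continue formally as constants (division by zero yields zero), so finite termination is
  expressed by a vanishing gradient and not by the length of the run.\<close>

definition bfgs_run ::
  "(real^'n \<Rightarrow> real) \<Rightarrow> real^'n \<Rightarrow> real^'n^'n \<Rightarrow> (nat \<Rightarrow> real^'n) \<Rightarrow> (nat \<Rightarrow> real^'n^'n) \<Rightarrow> bool" where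
  "bfgs_run F x0 B0 x B \<longleftrightarrow>
     x 0 = x0 \<and> B 0 = B0 \<and> sym_pos_def B0 \<and>
     (\<forall>k. bfgs_step F (x k) (B k) (x (Suc k)) (B (Suc k)))"

definition nonterminating :: "(real^'n \<Rightarrow> real) \<Rightarrow> (nat \<Rightarrow> real^'n) \<Rightarrow> bool" where
  "nonterminating F x \<longleftrightarrow> (\<forall>k. grad F (x k) \<noteq> 0)"

definition curvature_condition :: "(real^'n \<Rightarrow> real) \<Rightarrow> (nat \<Rightarrow> real^'n) \<Rightarrow> bool" where
  "curvature_condition F x \<longleftrightarrow>
     (\<forall>k. 0 < (x (Suc k) - x k) \<bullet> (grad F (x (Suc k)) - grad F (x k)))"

text \<open>The sequences over which the smallest possible Q-order is taken. The objective, the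
  starting point and the symmetric positive definite initial matrix are arbitrary.\<close>

definition bfgs_sequence_to :: "(real^'n \<Rightarrow> real) \<Rightarrow> (nat \<Rightarrow> real^'n) \<Rightarrow> real^'n \<Rightarrow> bool" where
  "bfgs_sequence_to F x z \<longleftrightarrow>
     smooth F \<and> strongly_convex F \<and> minimizer F z \<and> pos_def (hessian F z) \<and>
     (\<exists>x0 B0 B. bfgs_run F x0 B0 x B) \<and> nonterminating F x \<and> x \<longlonglongrightarrow> z"


subsection \<open>Rates of convergence\<close>

definition q_order_at_least :: "(nat \<Rightarrow> 'a::real_normed_vector) \<Rightarrow> 'a \<Rightarrow> real \<Rightarrow> bool" where
  "q_order_at_least x z p \<longleftrightarrow>
     x \<longlonglongrightarrow> z \<and> (\<forall>\<^sub>F k in sequentially. x k \<noteq> z) \<and> 1 \<le> p \<and>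
     (\<exists>C>0. \<exists>k0. \<forall>k\<ge>k0. norm (x (Suc k) - z) \<le> C * norm (x k - z) powr p)"

definition has_q_order :: "(nat \<Rightarrow> 'a::real_normed_vector) \<Rightarrow> 'a \<Rightarrow> bool" where
  "has_q_order x z \<longleftrightarrow> (\<exists>p. q_order_at_least x z p)"

text \<open>Extended real, since the admissible exponents may be unbounded; meaningful only under
  \<open>has_q_order\<close> (the supremum of the empty set is \<open>-\<infinity>\<close>).\<close>

definition q_order :: "(nat \<Rightarrow> 'a::real_normed_vector) \<Rightarrow> 'a \<Rightarrow> ereal" where
  "q_order x z = (SUP p\<in>{p. q_order_at_least x z p}. ereal p)"

definition q_superlinear :: "(nat \<Rightarrow> 'a::real_normed_vector) \<Rightarrow> 'a \<Rightarrow> bool" where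
  "q_superlinear x z \<longleftrightarrow> (\<lambda>k. norm (x (Suc k) - z) / norm (x k - z)) \<longlonglongrightarrow> 0"

end

theory Submission
  imports Defs
begin

text \<open>
  With exact line search, the secant equation makes the new direction \<open>d\<close> orthogonal to the last
  gradient difference, so in a plane the directions are determined by the gradients alone.
  Identify the plane with the complex numbers, choose real \<open>b k\<close> with \<open>b (-1) = 0\<close> and put
  \<open>g (k + 1) = (b (k - 1) + b k) / (b (k - 1) + i) * g k\<close> and \<open>x k = (1 - i b k) g k\<close>. Then
  \<open>x k\<close> are BFGS iterates for any strongly convex \<open>F\<close> whose gradient at \<open>x k\<close> is \<open>g k\<close>, and
  \<open>\<bar>x (k + 1)\<bar> / \<bar>x k\<bar>\<close> is about \<open>\<bar>b (k - 1) + b k\<bar>\<close>. The perturbation \<open>i b k g k\<close> of the gradient of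
  the quadratic is realized by a bump around \<open>x k\<close>; the sum of the bumps is smooth if \<open>b k\<close> is
  smaller than every power of \<open>\<bar>g k\<bar>\<close>. For even \<open>k\<close> take \<open>b k\<close> that small and \<open>b (k + 1)\<close> extremely
  close to \<open>- b k\<close>. By cancellation \<open>\<bar>g (k + 2)\<bar>\<close> is at most a high power of \<open>b k\<close>, whereas the
  next ratio is again of order \<open>b k\<close>: no Q-order above one is possible. Conversely, exact line
  search decreases \<open>F\<close>, which is comparable to the squared distance from the minimizer, so the
  Q-order is at least one.
\<close>

section \<open>Smooth functions\<close>

text \<open>Since \<open>frechet_derivative\<close> is a choice operator, uniqueness of the
  derivative is used once here; afterwards any explicitly given derivative may be differentiated
  further.\<close>

lemma C_diff_SucI:
  assumes "\<And>x. (f has_derivative f' x) (at x)" "\<And>v. C_diff k (\<lambda>x. f' x v)"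
  shows "C_diff (Suc k) f"
proof -
  have "frechet_derivative f (at x) = f' x" for x
    by (rule frechet_derivative_at[OF assms(1), symmetric])
  moreover have "f differentiable_on UNIV"
    using assms(1) differentiable_on_def differentiable_def by blast
  ultimately show ?thesis using assms(2) by simp
qed

lemma C_diff_SucD:
  assumes "C_diff (Suc k) f"
  shows "(f has_derivative frechet_derivative f (at x)) (at x)"
    "C_diff k (\<lambda>x. frechet_derivative f (at x) v)"
  using assms by (auto simp: differentiable_on_def frechet_derivative_works)

lemma C_diff_continuous_on:
  assumes "C_diff k f"
  shows "continuous_on UNIV f"
  using assms by (cases k) (auto intro: differentiable_imp_continuous_on)

lemma C_diff_lower:
  assumes "C_diff (Suc k) f"
  shows "C_diff k f"
  using assms
proof (induction k arbitrary: f)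
  case 0
  from C_diff_continuous_on[OF this] show ?case by simp
next
  case (Suc k)
  then show ?case by (metis C_diff.simps(2))
qed

lemma C_diff_const: "C_diff k (\<lambda>x. c)"
proof (induction k arbitrary: c)
  case (Suc k)
  then show ?case by (intro C_diff_SucI[where f' = "\<lambda>x v. 0"]) auto
qed simp

lemma C_diff_inner: "C_diff k (\<lambda>x. x \<bullet> u)"
proof (cases k)
  case 0
  then show ?thesis by (simp add: continuous_on_inner)
next
  case (Suc l)
  show ?thesis unfolding Suc
    by (rule C_diff_SucI[where f' = "\<lambda>x v. v \<bullet> u"])
      (auto intro!: derivative_eq_intros C_diff_const)
qed

lemma C_diff_add:
  assumes "C_diff k f" "C_diff k g"
  shows "C_diff k (\<lambda>x. f x + g x)"
  using assms
proof (induction k arbitrary: f g)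
  case 0
  then show ?case by (simp add: continuous_on_add)
next
  case (Suc k)
  show ?case
    by (rule C_diff_SucI[where f' = "\<lambda>x v. frechet_derivative f (at x) v + frechet_derivative g (at x) v"])
      (intro has_derivative_add C_diff_SucD[OF Suc.prems(1)] C_diff_SucD[OF Suc.prems(2)] Suc.IH)+
qed

lemma C_diff_mult:
  assumes "C_diff k f" "C_diff k g"
  shows "C_diff k (\<lambda>x. f x * g x)"
  using assms
proof (induction k arbitrary: f g)
  case 0
  then show ?case by (simp add: continuous_on_mult)
next
  case (Suc k)
  show ?case
    by (rule C_diff_SucI[where f' = "\<lambda>x v. f x * frechet_derivative g (at x) v + frechet_derivative f (at x) v * g x"])
      (intro has_derivative_mult C_diff_SucD[OF Suc.prems(1)] C_diff_SucD[OF Suc.prems(2)] Suc.IH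
        C_diff_add C_diff_lower[OF Suc.prems(1)] C_diff_lower[OF Suc.prems(2)])+
qed

lemma smooth_has_derivative:
  "smooth f \<Longrightarrow> (f has_derivative frechet_derivative f (at x)) (at x)"
  unfolding smooth_def using C_diff_SucD(1) by blast

lemma smooth_frechet_derivative:
  "smooth f \<Longrightarrow> smooth (\<lambda>x. frechet_derivative f (at x) v)"
  unfolding smooth_def using C_diff_SucD(2) by blast

lemma smooth_add: "smooth f \<Longrightarrow> smooth g \<Longrightarrow> smooth (\<lambda>x. f x + g x)"
  by (simp add: smooth_def C_diff_add)

lemma smooth_mult: "smooth f \<Longrightarrow> smooth g \<Longrightarrow> smooth (\<lambda>x. f x * g x)"
  by (simp add: smooth_def C_diff_mult)

lemma smooth_const: "smooth (\<lambda>x. c)"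
  by (simp add: smooth_def C_diff_const)

lemma smooth_inner: "smooth (\<lambda>x. x \<bullet> u)"
  by (simp add: smooth_def C_diff_inner)

lemma smooth_continuous_on: "smooth f \<Longrightarrow> continuous_on UNIV f"
  unfolding smooth_def using C_diff_continuous_on by blast

lemma std_quad_has_derivative: "(std_quad has_derivative (\<lambda>v. x \<bullet> v)) (at x)"
proof -
  have "((\<lambda>x. x \<bullet> x / 2) has_derivative (\<lambda>v. x \<bullet> v)) (at x)"
    by (auto intro!: derivative_eq_intros simp: inner_commute)
  moreover have "std_quad = (\<lambda>x::'a. x \<bullet> x / 2)"
    by (auto simp: std_quad_def power2_norm_eq_inner)
  ultimately show ?thesis by simp
qed

lemma smooth_std_quad: "smooth (std_quad :: 'a::euclidean_space \<Rightarrow> real)"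
  unfolding smooth_def
proof
  fix k
  \<comment> \<open>Passing through order \<open>Suc k\<close> treats all orders uniformly, order 0
    included, because the derivative of the quadratic is linear in the base point.\<close>
  have "C_diff (Suc k) (std_quad :: 'a \<Rightarrow> real)"
    by (rule C_diff_SucI[OF std_quad_has_derivative]) (rule C_diff_inner)
  then show "C_diff k (std_quad :: 'a \<Rightarrow> real)" by (rule C_diff_lower)
qed

section \<open>Sums of smooth bumps\<close>

definition flat :: "nat \<Rightarrow> real \<Rightarrow> real" where
  "flat k t = (if 0 < t then exp (- 1 / t) / t ^ k else 0)"

text \<open>Keeping only the term of degree \<open>k + 2\<close> in the series of exp (1 / t) bounds
  exp (- 1 / t) by (k + 2)! t^(k + 2). The two spare powers of t yield the derivative 0 at t =
  0.\<close>

lemma flat_le: "\<bar>flat k t\<bar> \<le> fact (k + 2) * t\<^sup>2"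
proof (cases "0 < t")
  case True
  let ?n = "k + 2"
  have "(1 / t) ^ ?n / fact ?n \<le> exp (1 / t)"
    using sum_le_suminf[OF summable_exp_generic[of "1/t"], of "{?n}"] True
    by (simp add: exp_def divide_inverse mult.commute del: power_Suc)
  then have "1 \<le> fact ?n * t ^ ?n * exp (1 / t)"
    using True by (simp add: power_one_over pos_divide_le_eq mult_ac del: fact_Suc power_Suc add_2_eq_Suc')
  from mult_left_mono[OF this, of "exp (- 1 / t)"]
  have "exp (- 1 / t) \<le> fact ?n * t ^ ?n"
    by (simp add: exp_minus field_simps del: fact_Suc power_Suc add_2_eq_Suc')
  also have "\<dots> = (fact ?n * t\<^sup>2) * t ^ k"
    by (simp add: power_add del: fact_Suc add_2_eq_Suc')
  finally show ?thesis
    using True by (simp add: flat_def divide_le_eq del: fact_Suc add_2_eq_Suc')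
qed (simp add: flat_def)

text \<open>The index closes the family under differentiation up to linear combinations, so
  smoothness of the bumps follows by induction on the order for all indices at once.\<close>

lemma flat_has_real_derivative:
  "(flat k has_real_derivative flat (k + 2) t - real k * flat (k + 1) t) (at t)"
proof -
  consider "0 < t" | "t < 0" | "t = 0" by linarith
  then show ?thesis
  proof cases
    case 1
    have "((\<lambda>t. exp (- 1 / t) * inverse t ^ k) has_real_derivative
        flat (k + 2) t - real k * flat (k + 1) t) (at t)"
    proof -
      have *: "((\<lambda>t. inverse t ^ k) has_real_derivative - real k * inverse t ^ (k + 1)) (at t)"
        using 1 DERIV_power[OF DERIV_inverse, of t k] by (cases k) (simp_all add: algebra_simps)
      have "((\<lambda>t. exp (- 1 / t)) has_real_derivative exp (- 1 / t) * (inverse t)\<^sup>2) (at t)"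
        using 1 by (auto intro!: derivative_eq_intros simp: divide_inverse power2_eq_square)
      from DERIV_mult[OF this *] show ?thesis
        using 1 by (simp add: flat_def divide_inverse power_inverse algebra_simps power2_eq_square)
    qed
    then show ?thesis
      by (rule has_field_derivative_transform_within_open[of _ _ _ "{0<..}"])
        (use 1 in \<open>simp_all add: flat_def divide_inverse power_inverse\<close>)
  next
    case 2
    have "((\<lambda>t. 0) has_real_derivative flat (k + 2) t - real k * flat (k + 1) t) (at t)"
      using 2 by (auto simp: flat_def)
    then show ?thesis
      by (rule has_field_derivative_transform_within_open[of _ _ _ "{..<0}"])
        (use 2 in \<open>auto simp: flat_def\<close>)
  next
    case 3
    have "((\<lambda>h. fact (k + 2) * \<bar>h\<bar> :: real) \<longlongrightarrow> fact (k + 2) * \<bar>0\<bar>) (at 0)"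
      by (intro tendsto_intros)
    then have *: "((\<lambda>h. fact (k + 2) * \<bar>h\<bar> :: real) \<longlongrightarrow> 0) (at 0)"
      by simp
    have "((\<lambda>h. flat k h / h) \<longlongrightarrow> 0) (at 0)"
    proof (rule Lim_null_comparison[OF _ *])
      have "norm (flat k h / h) \<le> fact (k + 2) * \<bar>h\<bar>" if "h \<noteq> 0" for h
        using flat_le[of k h] that
        by (simp add: abs_divide divide_le_eq power2_eq_square mult.assoc)
      then show "\<forall>\<^sub>F h in at 0. norm (flat k h / h) \<le> fact (k + 2) * \<bar>h\<bar>"
        by (auto simp: eventually_at_filter)
    qed
    then show ?thesis
      using 3 by (simp add: DERIV_def flat_def)
  qed
qed

definition bump :: "nat \<Rightarrow> 'a::euclidean_space \<Rightarrow> real" where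
  "bump k y = flat k (1 - y \<bullet> y)"

lemma C_diff_bump: "C_diff m (bump k)"
proof (induction m arbitrary: k)
  case 0
  have "continuous_on UNIV (flat k)"
    by (intro continuous_at_imp_continuous_on ballI DERIV_isCont[OF flat_has_real_derivative])
  then show ?case
    unfolding bump_def[abs_def] C_diff.simps
    by (rule continuous_on_compose2) (auto intro!: continuous_intros)
next
  case (Suc m)
  let ?D = "\<lambda>(y::'a) v. (bump (k + 2) y + - real k * bump (k + 1) y) * (- 2 * (y \<bullet> v))"
  show ?case
  proof (rule C_diff_SucI[where f' = ?D])
    fix y :: 'a
    have "((\<lambda>y. 1 - y \<bullet> y) has_derivative (\<lambda>v. - 2 * (y \<bullet> v))) (at y)"
      by (auto intro!: derivative_eq_intros simp: inner_commute)
    from DERIV_compose_FDERIV[OF flat_has_real_derivative this]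
    show "(bump k has_derivative ?D y) (at y)"
      by (simp add: bump_def[abs_def] mult.commute)
  next
    fix v :: 'a
    show "C_diff m (\<lambda>y. ?D y v)"
      by (intro C_diff_mult C_diff_add C_diff_const C_diff_inner Suc)
  qed
qed

section \<open>Test functions on the unit ball\<close>

definition linear_bump :: "'a \<Rightarrow> 'a::euclidean_space \<Rightarrow> real" where
  "linear_bump u y = exp 1 * (bump 0 y * (y \<bullet> u))"

text \<open>Vanishing on the open exterior of the unit ball is inherited by directional derivatives,
  so one class serves every order of differentiation.\<close>

definition test_fun :: "('a::euclidean_space \<Rightarrow> real) \<Rightarrow> bool" where
  "test_fun \<psi> \<longleftrightarrow> smooth \<psi> \<and> (\<forall>y. 1 < norm y \<longrightarrow> \<psi> y = 0)"

lemma test_fun_linear_bump: "test_fun (linear_bump u)"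
proof -
  have "smooth (bump 0 :: 'a \<Rightarrow> real)"
    by (simp add: smooth_def C_diff_bump)
  then have "smooth (linear_bump u)"
    unfolding linear_bump_def[abs_def] by (intro smooth_mult smooth_const smooth_inner)
  moreover have "linear_bump u y = 0" if "1 < norm y" for y
  proof -
    have "1 < norm y ^ 2" using that by (simp add: one_less_power)
    then show ?thesis by (simp add: linear_bump_def bump_def flat_def power2_norm_eq_inner)
  qed
  ultimately show ?thesis by (simp add: test_fun_def)
qed

text \<open>The factor \<open>exp 1\<close> cancels the value exp (- 1) of the bump at its centre,
  and the other term of the product rule vanishes with the linear factor. Hence the gradient at the
  centre is exactly \<open>u\<close>.\<close>

lemma linear_bump_derivative_0: "frechet_derivative (linear_bump u) (at 0) v = u \<bullet> v"
proof -
  have s: "smooth (bump 0 :: 'a \<Rightarrow> real)"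
    by (simp add: smooth_def C_diff_bump)
  have b: "bump 0 (0::'a) = exp (- 1)" by (simp add: bump_def flat_def)
  have "(linear_bump u has_derivative (\<lambda>v. exp 1 * (bump 0 (0::'a) * (v \<bullet> u)
      + frechet_derivative (bump 0) (at 0) v * (0 \<bullet> u)))) (at 0)"
    unfolding linear_bump_def[abs_def]
    using has_derivative_mult_right[OF has_derivative_mult[OF smooth_has_derivative[OF s, of 0]
        has_derivative_inner_left[OF has_derivative_ident, of u]], of "exp 1"] by simp
  then have "(linear_bump u has_derivative (\<lambda>v. u \<bullet> v)) (at 0)"
    by (simp add: b inner_commute exp_minus_inverse flip: mult.assoc)
  from frechet_derivative_at[OF this, symmetric] show ?thesis by simp
qed

lemma test_fun_derivative_eq_0:
  assumes "test_fun \<psi>" "1 < norm y"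
  shows "frechet_derivative \<psi> (at y) v = 0"
proof -
  have "((\<lambda>x. 0) has_derivative (\<lambda>v. 0)) (at y)" by simp
  moreover have "open {y::'a. 1 < norm y}"
    by (intro open_Collect_less continuous_intros)
  ultimately have "(\<psi> has_derivative (\<lambda>v. 0)) (at y)"
    by (rule has_derivative_transform_within_open) (use assms in \<open>auto simp: test_fun_def\<close>)
  from frechet_derivative_at[OF this, symmetric] show ?thesis by simp
qed

lemma test_fun_derivative:
  "test_fun \<psi> \<Longrightarrow> test_fun (\<lambda>x. frechet_derivative \<psi> (at x) v)"
  using test_fun_derivative_eq_0 smooth_frechet_derivative by (auto simp: test_fun_def)

lemma test_fun_bounded:
  assumes "test_fun (\<psi> :: 'a::euclidean_space \<Rightarrow> real)"
  obtains M where "M > 0" "\<And>y. \<bar>\<psi> y\<bar> \<le> M"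
proof -
  have "compact (\<psi> ` cball 0 1)"
    using assms unfolding test_fun_def
    by (intro compact_continuous_image continuous_on_subset[OF smooth_continuous_on]) auto
  then obtain M where M: "M > 0" "\<And>y. y \<in> cball 0 1 \<Longrightarrow> norm (\<psi> y) \<le> M"
    unfolding bounded_pos[symmetric] by (auto dest!: compact_imp_bounded simp: bounded_pos)
  have "\<bar>\<psi> y\<bar> \<le> M" for y
    using M(1) M(2)[of y] assms by (cases "norm y \<le> 1") (auto simp: test_fun_def)
  with M(1) that show ?thesis by blast
qed

text \<open>Bounds for the finitely many basis directions combine by linearity into one constant for
  all directions.\<close>

lemma test_fun_derivative_bounded:
  assumes "test_fun (\<psi> :: 'a::euclidean_space \<Rightarrow> real)"
  obtains M where "M > 0" "\<And>y v. \<bar>frechet_derivative \<psi> (at y) v\<bar> \<le> M * norm v"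
proof -
  have "\<exists>M. M > 0 \<and> (\<forall>y. \<bar>frechet_derivative \<psi> (at y) u\<bar> \<le> M)" for u
    by (rule test_fun_bounded[OF test_fun_derivative[OF assms, of u]]) blast
  then obtain M where M: "\<And>u. M u > 0" "\<And>u y. \<bar>frechet_derivative \<psi> (at y) u\<bar> \<le> M u"
    by metis
  show ?thesis
  proof
    show "sum M Basis > 0" using M(1) by (simp add: sum_pos)
    fix y v
    have "linear (frechet_derivative \<psi> (at y))"
      using assms has_derivative_linear[OF smooth_has_derivative] by (auto simp: test_fun_def)
    then have "frechet_derivative \<psi> (at y) v
        = (\<Sum>u\<in>Basis. (v \<bullet> u) * frechet_derivative \<psi> (at y) u)"
      by (subst euclidean_representation[of v, symmetric])
        (simp add: linear_sum linear_scale)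
    also have "\<bar>\<dots>\<bar> \<le> (\<Sum>u\<in>Basis. \<bar>v \<bullet> u\<bar> * \<bar>frechet_derivative \<psi> (at y) u\<bar>)"
      by (rule order_trans[OF sum_abs]) (simp add: abs_mult)
    also have "\<dots> \<le> (\<Sum>u\<in>Basis. norm v * M u)"
      using M by (intro sum_mono mult_mono) (auto simp: Basis_le_norm)
    finally show "\<bar>frechet_derivative \<psi> (at y) v\<bar> \<le> sum M Basis * norm v"
      by (simp add: sum_distrib_left sum_distrib_right mult.commute)
  qed
qed

section \<open>Series of rescaled bumps and their termwise derivatives\<close>

definition bump_series ::
  "(nat \<Rightarrow> real) \<Rightarrow> (nat \<Rightarrow> real) \<Rightarrow> (nat \<Rightarrow> 'a) \<Rightarrow> ('a::euclidean_space \<Rightarrow> real) \<Rightarrow> 'a \<Rightarrow> real" where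
  "bump_series a r c \<psi> x = (\<Sum>k. a k * \<psi> ((x - c k) /\<^sub>R r k))"

lemma bump_series_summable:
  fixes a :: "nat \<Rightarrow> real"
  assumes "summable (\<lambda>k. \<bar>a k\<bar>)" "\<And>y. \<bar>\<psi> y\<bar> \<le> M"
  shows "summable (\<lambda>k. a k * \<psi> ((x - c k) /\<^sub>R r k))"
proof (rule summable_comparison_test')
  show "summable (\<lambda>k. \<bar>a k\<bar> * M)"
    using assms(1) by (rule summable_mult2)
  show "norm (a k * \<psi> ((x - c k) /\<^sub>R r k)) \<le> \<bar>a k\<bar> * M" for k
    using assms(2) by (auto simp: abs_mult intro!: mult_left_mono)
qed

lemma bump_series_bound:
  fixes a :: "nat \<Rightarrow> real"
  assumes "summable (\<lambda>k. \<bar>a k\<bar>)" "\<And>y. \<bar>\<psi> y\<bar> \<le> M"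
  shows "\<bar>bump_series a r c \<psi> x\<bar> \<le> (\<Sum>k. \<bar>a k\<bar>) * M"
proof -
  have "norm (\<Sum>k. a k * \<psi> ((x - c k) /\<^sub>R r k)) \<le> (\<Sum>k. \<bar>a k\<bar> * M)"
  proof (rule norm_suminf_le)
    show "summable (\<lambda>k. \<bar>a k\<bar> * M)"
      using assms(1) by (rule summable_mult2)
    show "norm (a k * \<psi> ((x - c k) /\<^sub>R r k)) \<le> \<bar>a k\<bar> * M" for k
      using assms(2) by (auto simp: abs_mult intro!: mult_left_mono)
  qed
  also have "\<dots> = (\<Sum>k. \<bar>a k\<bar>) * M"
    using suminf_mult2[OF assms(1)] by simp
  finally show ?thesis by (simp add: bump_series_def)
qed

lemma norm_scaleR_gt_1: "0 < r \<Longrightarrow> r < norm z \<Longrightarrow> 1 < norm (z /\<^sub>R r)"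
  by (simp add: field_simps)

lemma bump_series_single:
  assumes "test_fun \<psi>" "\<And>k. 0 < r k" "\<And>k. k \<noteq> l \<Longrightarrow> r k < norm (x - c k)"
  shows "bump_series a r c \<psi> x = a l * \<psi> ((x - c l) /\<^sub>R r l)"
proof -
  have "\<psi> ((x - c k) /\<^sub>R r k) = 0" if "k \<noteq> l" for k
    using assms(1) norm_scaleR_gt_1[OF assms(2)[of k] assms(3)[OF that]]
    by (simp add: test_fun_def)
  then show ?thesis
    unfolding bump_series_def by (subst suminf_finite[of "{l}"]) auto
qed

lemma bump_series_eq_0:
  assumes "test_fun \<psi>" "\<And>k. 0 < r k" "\<And>k. r k < norm (x - c k)"
  shows "bump_series a r c \<psi> x = 0"
  using bump_series_single[of \<psi> r 0 x c a] norm_scaleR_gt_1[OF assms(2,3), of 0] assms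
  by (simp add: test_fun_def)

text \<open>By the chain rule each term acquires a factor \<open>1 / r k\<close>. The resulting
  majorant is summable and independent of the point, so the series may be differentiated termwise,
  and the result is again a \<open>bump_series\<close> with the same centres and radii.\<close>

lemma bump_series_has_derivative:
  fixes \<psi> :: "'a::euclidean_space \<Rightarrow> real"
  assumes r: "\<And>k. 0 < r k" and a: "summable (\<lambda>k. \<bar>a k\<bar>)" "summable (\<lambda>k. \<bar>a k\<bar> / r k)"
    and \<psi>: "test_fun \<psi>"
  shows "(bump_series a r c \<psi> has_derivative
    (\<lambda>v. bump_series (\<lambda>k. a k / r k) r c (\<lambda>y. frechet_derivative \<psi> (at y) v) x)) (at x)"
proof -
  define D where "D y = frechet_derivative \<psi> (at y)" for y
  have D: "(\<psi> has_derivative D y) (at y)" for y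
    unfolding D_def using \<psi> smooth_has_derivative by (auto simp: test_fun_def)
  obtain M where M: "M > 0" "\<And>y. \<bar>\<psi> y\<bar> \<le> M"
    using test_fun_bounded[OF \<psi>] by blast
  obtain K where K: "K > 0" "\<And>y v. \<bar>D y v\<bar> \<le> K * norm v"
    unfolding D_def using test_fun_derivative_bounded[OF \<psi>] by blast
  let ?f = "\<lambda>k x. a k * \<psi> ((x - c k) /\<^sub>R r k)"
  let ?f' = "\<lambda>k x v. a k / r k * D ((x - c k) /\<^sub>R r k) v"
  let ?g' = "\<lambda>x v. \<Sum>k. ?f' k x v"
  have f': "(?f k has_derivative ?f' k x) (at x within UNIV)" for k x
  proof -
    have "((\<lambda>x. (x - c k) /\<^sub>R r k) has_derivative (\<lambda>v. v /\<^sub>R r k)) (at x)"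
      by (auto intro!: derivative_eq_intros)
    from has_derivative_mult_right[OF has_derivative_compose[OF this D]]
    have "(?f k has_derivative (\<lambda>v. a k * D ((x - c k) /\<^sub>R r k) (v /\<^sub>R r k))) (at x)" .
    then show ?thesis
      by (simp add: linear_scale[OF has_derivative_linear[OF D]] divide_inverse mult.assoc)
  qed
  have bound: "norm (?f' k x v) \<le> \<bar>a k\<bar> / r k * K * norm v" for k x v
    using mult_left_mono[OF K(2), of "\<bar>a k\<bar> / r k" "(x - c k) /\<^sub>R r k" v] r[of k]
    by (simp add: abs_mult mult.assoc)
  have sumK: "summable (\<lambda>k. \<bar>a k\<bar> / r k * K)"
    using a(2) by (rule summable_mult2)
  have sum': "summable (\<lambda>k. ?f' k x v)" for x v
    by (rule summable_comparison_test'[OF summable_mult2[OF sumK, of "norm v"]]) (rule bound)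
  \<comment> \<open>Uniform convergence in operator norm: the remainder is dominated by the tail of
    the majorant \<open>sumK\<close>.\<close>
  have unif: "\<forall>\<^sub>F n in sequentially. \<forall>x\<in>UNIV. \<forall>v.
      norm (sum (\<lambda>k. ?f' k x v) {..<n} - ?g' x v) \<le> e * norm v" if "e > 0" for e
  proof -
    obtain N where N: "\<And>n. n \<ge> N \<Longrightarrow> norm (\<Sum>k. \<bar>a (k + n)\<bar> / r (k + n) * K) < e"
      using suminf_exist_split[OF \<open>e > 0\<close> sumK] by blast
    have "norm (sum (\<lambda>k. ?f' k x v) {..<n} - ?g' x v) \<le> e * norm v" if n: "n \<ge> N" for n x v
    proof -
      have "norm (sum (\<lambda>k. ?f' k x v) {..<n} - ?g' x v) = norm (\<Sum>k. ?f' (k + n) x v)"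
        by (subst suminf_minus_initial_segment[OF sum'[of x v], of n]) (rule norm_minus_commute)
      also have "\<dots> \<le> (\<Sum>k. \<bar>a (k + n)\<bar> / r (k + n) * K * norm v)"
        by (rule norm_suminf_le[OF bound])
          (rule summable_mult2[OF summable_ignore_initial_segment[OF sumK]])
      also have "\<dots> = (\<Sum>k. \<bar>a (k + n)\<bar> / r (k + n) * K) * norm v"
        by (rule suminf_mult2[symmetric]) (rule summable_ignore_initial_segment[OF sumK])
      also have "\<dots> \<le> e * norm v"
        using N[OF n] by (intro mult_right_mono) auto
      finally show ?thesis .
    qed
    then show ?thesis by (auto simp: eventually_sequentially)
  qed
  have sums: "(\<lambda>k. ?f k x) sums bump_series a r c \<psi> x" for x
    unfolding bump_series_def by (rule summable_sums[OF bump_series_summable[OF a(1) M(2)]])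
  have "\<exists>g. \<forall>x\<in>UNIV. (\<lambda>k. ?f k x) sums g x \<and> (g has_derivative ?g' x) (at x within UNIV)"
    by (rule has_derivative_series[where f' = ?f' and x = 0, OF convex_UNIV f' unif UNIV_I sums])
  then obtain g where g: "\<And>x. (\<lambda>k. ?f k x) sums g x" "\<And>x. (g has_derivative ?g' x) (at x)"
    by blast
  have "g = bump_series a r c \<psi>"
    by (rule ext) (rule sums_unique2[OF g(1) sums])
  with g(2) show ?thesis by (simp add: bump_series_def[abs_def] D_def)
qed

text \<open>One differentiation replaces \<open>a\<close> by \<open>a k / r k\<close> and the
  profile by a directional derivative. Summability against all powers of \<open>1 / r k\<close> is
  stable under this, which is why the induction generalises over both.\<close>

lemma C_diff_bump_series:
  fixes \<psi> :: "'a::euclidean_space \<Rightarrow> real"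
  assumes r: "\<And>k. 0 < r k" and a: "\<And>m. summable (\<lambda>k. \<bar>a k\<bar> / r k ^ m)" and \<psi>: "test_fun \<psi>"
  shows "C_diff n (bump_series a r c \<psi>)"
  using a \<psi>
proof (induction n arbitrary: a \<psi>)
  case 0
  have "(bump_series a r c \<psi> has_derivative
    (\<lambda>v. bump_series (\<lambda>k. a k / r k) r c (\<lambda>y. frechet_derivative \<psi> (at y) v) x)) (at x)" for x
    using 0(1)[of 0] 0(1)[of 1] by (intro bump_series_has_derivative r 0(2)) simp_all
  from has_derivative_continuous[OF this] show ?case
    by (simp add: continuous_at_imp_continuous_on)
next
  case (Suc n)
  show ?case
  proof (rule C_diff_SucI[OF bump_series_has_derivative])
    show "summable (\<lambda>k. \<bar>a k\<bar>)" "summable (\<lambda>k. \<bar>a k\<bar> / r k)"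
      using Suc.prems(1)[of 0] Suc.prems(1)[of 1] by auto
    show "C_diff n (bump_series (\<lambda>k. a k / r k) r c (\<lambda>y. frechet_derivative \<psi> (at y) v))" for v
    proof (rule Suc.IH[OF _ test_fun_derivative[OF Suc.prems(2)]])
      show "summable (\<lambda>k. \<bar>a k / r k\<bar> / r k ^ m)" for m
        using Suc.prems(1)[of "Suc m"] r by (simp add: abs_of_pos)
    qed
  qed (use r Suc.prems in auto)
qed

text \<open>Expanding \<open>v\<close> in the basis leaves finitely many first derivatives, each a
  test function with its own derivative bound; their constants add up to one bilinear bound.\<close>

lemma test_fun_second_derivative_bounded:
  assumes \<psi>: "test_fun (\<psi> :: 'a::euclidean_space \<Rightarrow> real)"
  obtains M where "M > 0"
    "\<And>y u v. \<bar>frechet_derivative (\<lambda>y. frechet_derivative \<psi> (at y) v) (at y) u\<bar> \<le> M * norm u * norm v"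
proof -
  let ?D = "\<lambda>v y. frechet_derivative \<psi> (at y) v"
  have sm: "smooth (?D v)" for v
    using test_fun_derivative[OF \<psi>] by (simp add: test_fun_def)
  have "\<exists>K. K > 0 \<and> (\<forall>y u. \<bar>frechet_derivative (?D v) (at y) u\<bar> \<le> K * norm u)" for v
    by (rule test_fun_derivative_bounded[OF test_fun_derivative[OF \<psi>, of v]]) blast
  then obtain K where K: "\<And>v. K v > 0"
      "\<And>v y u. \<bar>frechet_derivative (?D v) (at y) u\<bar> \<le> K v * norm u"
    by metis
  show ?thesis
  proof
    show "sum K Basis > 0" using K(1) by (simp add: sum_pos)
    fix y u v
    have "?D v = (\<lambda>y. \<Sum>w\<in>Basis. (v \<bullet> w) * ?D w y)"
    proof
      fix y
      have "linear (frechet_derivative \<psi> (at y))"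
        using \<psi> has_derivative_linear[OF smooth_has_derivative] by (auto simp: test_fun_def)
      then show "?D v y = (\<Sum>w\<in>Basis. (v \<bullet> w) * ?D w y)"
        by (subst euclidean_representation[of v, symmetric]) (simp add: linear_sum linear_scale)
    qed
    moreover have "((\<lambda>y. \<Sum>w\<in>Basis. (v \<bullet> w) * ?D w y) has_derivative
        (\<lambda>u. \<Sum>w\<in>Basis. (v \<bullet> w) * frechet_derivative (?D w) (at y) u)) (at y)"
      by (rule has_derivative_sum) (rule has_derivative_mult_right[OF smooth_has_derivative[OF sm]])
    ultimately have "(?D v has_derivative
        (\<lambda>u. \<Sum>w\<in>Basis. (v \<bullet> w) * frechet_derivative (?D w) (at y) u)) (at y)"
      by simp
    from fun_cong[OF frechet_derivative_at[OF this, symmetric]]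
    have "frechet_derivative (?D v) (at y) u
        = (\<Sum>w\<in>Basis. (v \<bullet> w) * frechet_derivative (?D w) (at y) u)" .
    also have "\<bar>\<dots>\<bar> \<le> (\<Sum>w\<in>Basis. \<bar>v \<bullet> w\<bar> * \<bar>frechet_derivative (?D w) (at y) u\<bar>)"
      by (rule order_trans[OF sum_abs]) (simp add: abs_mult)
    also have "\<dots> \<le> (\<Sum>w\<in>Basis. norm v * (K w * norm u))"
      using K(2) by (intro sum_mono mult_mono) (auto simp: Basis_le_norm)
    also have "\<dots> = sum K Basis * norm u * norm v"
      by (simp add: sum_distrib_left sum_distrib_right mult_ac)
    finally show "\<bar>frechet_derivative (?D v) (at y) u\<bar> \<le> sum K Basis * norm u * norm v" .
  qed
qed

lemma frechet_derivative_bump_series: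
  assumes "\<And>k. 0 < r k" "\<And>m. summable (\<lambda>k. \<bar>a k\<bar> / r k ^ m)" "test_fun \<psi>"
  shows "frechet_derivative (bump_series a r c \<psi>) (at x) v
    = bump_series (\<lambda>k. a k / r k) r c (\<lambda>y. frechet_derivative \<psi> (at y) v) x"
proof -
  have "summable (\<lambda>k. \<bar>a k\<bar>)" "summable (\<lambda>k. \<bar>a k\<bar> / r k)"
    using assms(2)[of 0] assms(2)[of 1] by simp_all
  from frechet_derivative_at[OF bump_series_has_derivative[OF assms(1) this assms(3)], symmetric]
  show ?thesis by simp
qed

lemma summable_divide_power_Suc:
  fixes a r :: "nat \<Rightarrow> real"
  assumes "\<And>k. 0 < r k" "\<And>m. summable (\<lambda>k. \<bar>a k\<bar> / r k ^ m)"
  shows "summable (\<lambda>k. \<bar>a k / r k\<bar> / r k ^ m)"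
  using assms(2)[of "Suc m"] assms(1) by (simp add: abs_divide abs_of_pos[OF assms(1)])

lemma second_derivative_bump_series:
  assumes "\<And>k. 0 < r k" "\<And>m. summable (\<lambda>k. \<bar>a k\<bar> / r k ^ m)" "test_fun \<psi>"
  shows "frechet_derivative (\<lambda>x. frechet_derivative (bump_series a r c \<psi>) (at x) v) (at x) u
    = bump_series (\<lambda>k. a k / r k / r k) r c
        (\<lambda>y. frechet_derivative (\<lambda>y. frechet_derivative \<psi> (at y) v) (at y) u) x"
  unfolding frechet_derivative_bump_series[OF assms]
  by (rule frechet_derivative_bump_series[OF assms(1) summable_divide_power_Suc[OF assms(1,2)]
      test_fun_derivative[OF assms(3)]])

lemma smooth_bump_series:
  assumes "\<And>k. 0 < r k" "\<And>m. summable (\<lambda>k. \<bar>a k\<bar> / r k ^ m)" "test_fun \<psi>"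
  shows "smooth (bump_series a r c \<psi>)"
  unfolding smooth_def using C_diff_bump_series[OF assms] by blast

section \<open>Strong convexity, gradient and Hessian\<close>

text \<open>Divide the convexity inequality on the segment from \<open>x\<close> to \<open>y\<close>
  by the parameter \<open>s\<close> and let \<open>s\<close> tend to 0 from the right.\<close>

lemma strongly_convex_obtain:
  assumes "strongly_convex f"
  obtains m where "m > 0"
    "\<And>x y f'. (f has_derivative f') (at x) \<Longrightarrow> f x + f' (y - x) + m / 2 * (norm (y - x))\<^sup>2 \<le> f y"
proof -
  from assms obtain m where m: "m > 0" and conv: "\<And>x y t. t \<in> {0..1} \<Longrightarrow> f ((1 - t) *\<^sub>R x + t *\<^sub>R y)
       \<le> (1 - t) * f x + t * f y - m / 2 * t * (1 - t) * (norm (x - y))\<^sup>2"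
    unfolding strongly_convex_def by metis
  show ?thesis
  proof
    fix x y f' assume f': "(f has_derivative f') (at x)"
    let ?\<phi> = "\<lambda>s. f (x + s *\<^sub>R (y - x))"
    have "((\<lambda>s. x + s *\<^sub>R (y - x)) has_derivative (\<lambda>s. s *\<^sub>R (y - x))) (at 0)"
      by (auto intro!: derivative_eq_intros)
    from has_derivative_compose[OF this, of f f'] f'
    have "(?\<phi> has_derivative (\<lambda>s. f' (s *\<^sub>R (y - x)))) (at 0)" by simp
    then have "(?\<phi> has_real_derivative f' (y - x)) (at 0)"
      by (simp add: has_field_derivative_def linear_scale[OF has_derivative_linear[OF f']]
          mult_commute_abs)
    then have lim: "((\<lambda>s. (?\<phi> s - ?\<phi> 0) / s) \<longlongrightarrow> f' (y - x)) (at_right 0)"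
      by (auto simp: DERIV_def intro: tendsto_mono[OF at_le])
    have "((\<lambda>s. f y - f x - m / 2 * (1 - s) * (norm (y - x))\<^sup>2) \<longlongrightarrow>
        f y - f x - m / 2 * (1 - 0) * (norm (y - x))\<^sup>2) (at_right 0)"
      by (intro tendsto_intros)
    note lim' = this
    have "f' (y - x) \<le> f y - f x - m / 2 * (1 - 0) * (norm (y - x))\<^sup>2"
    proof (rule tendsto_le[OF _ lim' lim])
      show "\<forall>\<^sub>F s in at_right 0. (?\<phi> s - ?\<phi> 0) / s \<le> f y - f x - m / 2 * (1 - s) * (norm (y - x))\<^sup>2"
        unfolding eventually_at_right_field
      proof (intro exI[of _ 1] conjI allI impI)
        fix s :: real assume s: "0 < s" "s < 1"
        have "x + s *\<^sub>R (y - x) = (1 - s) *\<^sub>R x + s *\<^sub>R y"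
          by (simp add: algebra_simps)
        then have "?\<phi> s - f x \<le> s * (f y - f x - m / 2 * (1 - s) * (norm (y - x))\<^sup>2)"
          using conv[of s x y] s by (simp add: algebra_simps norm_minus_commute)
        then show "(?\<phi> s - ?\<phi> 0) / s \<le> f y - f x - m / 2 * (1 - s) * (norm (y - x))\<^sup>2"
          using s by (simp add: pos_divide_le_eq mult.commute)
      qed simp
    qed simp
    then show "f x + f' (y - x) + m / 2 * (norm (y - x))\<^sup>2 \<le> f y" by simp
  qed (rule m)
qed

text \<open>Split the quadratic into parts of weight \<eta> and 1 - \<eta>. The first part makes the
  restriction of \<open>S\<close> to every line convex, by the sign of the second derivative; the
  second supplies the modulus of strong convexity.\<close>

lemma strongly_convex_std_quad_add:
  fixes S :: "'a::euclidean_space \<Rightarrow> real"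
  assumes S: "smooth S" and \<eta>: "0 \<le> \<eta>" "\<eta> < 1"
    and bound: "\<And>x v. \<bar>frechet_derivative (\<lambda>x. frechet_derivative S (at x) v) (at x) v\<bar> \<le> \<eta> * (norm v)\<^sup>2"
  shows "strongly_convex (\<lambda>x. std_quad x + S x)"
  unfolding strongly_convex_def
proof (intro exI[of _ "1 - \<eta>"] conjI allI ballI)
  fix x y :: 'a and t :: real assume t: "t \<in> {0..1}"
  define d where "d = y - x"
  let ?p = "\<lambda>s. x + s *\<^sub>R d"
  define S' where "S' z = frechet_derivative S (at z) d" for z
  define G where "G s = \<eta> / 2 * (?p s \<bullet> ?p s) + S (?p s)" for s
  have along: "((\<lambda>s. h (?p s)) has_real_derivative frechet_derivative h (at (?p s)) d) (at s)"
    if "smooth h" for h s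
  proof -
    have "(?p has_derivative (\<lambda>s. s *\<^sub>R d)) (at s)"
      by (auto intro!: derivative_eq_intros)
    from has_derivative_compose[OF this smooth_has_derivative[OF that]]
    show ?thesis
      by (simp add: has_field_derivative_def mult_commute_abs
          linear_scale[OF has_derivative_linear[OF smooth_has_derivative[OF that]]])
  qed
  have sq: "((\<lambda>s. ?p s \<bullet> ?p s) has_real_derivative 2 * (?p s \<bullet> d)) (at s)" for s
    by (auto intro!: derivative_eq_intros simp: has_field_derivative_def fun_eq_iff inner_commute algebra_simps)
  have lin: "((\<lambda>s. ?p s \<bullet> d) has_real_derivative d \<bullet> d) (at s)" for s
    by (auto intro!: derivative_eq_intros simp: has_field_derivative_def fun_eq_iff algebra_simps)
  have "convex_on UNIV G"
  proof (rule f''_ge0_imp_convex)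
    show "(G has_real_derivative \<eta> * (?p s \<bullet> d) + S' (?p s)) (at s)" for s
      unfolding G_def[abs_def] S'_def
      using DERIV_add[OF DERIV_cmult[OF sq, of "\<eta> / 2" s] along[OF S, of s]] by simp
    show "((\<lambda>s. \<eta> * (?p s \<bullet> d) + S' (?p s)) has_real_derivative
        \<eta> * (d \<bullet> d) + frechet_derivative S' (at (?p s)) d) (at s)" for s
      using DERIV_add[OF DERIV_cmult[OF lin, of \<eta> s]
          along[OF smooth_frechet_derivative[OF S, of d], of s]]
      by (simp add: S'_def[abs_def])
    show "0 \<le> \<eta> * (d \<bullet> d) + frechet_derivative S' (at (?p s)) d" for s
      using bound[of d "?p s"] by (simp add: S'_def[abs_def] power2_norm_eq_inner abs_le_iff)
  qed simp
  from convex_onD[OF this, of t 0 1] t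
  have "G t \<le> (1 - t) * G 0 + t * G 1" by simp
  moreover have "?p t = (1 - t) *\<^sub>R x + t *\<^sub>R y" "?p 1 = y"
    by (simp_all add: d_def algebra_simps)
  moreover have "?p t \<bullet> ?p t = (1 - t) * (x \<bullet> x) + t * (y \<bullet> y) - t * (1 - t) * (d \<bullet> d)"
    by (simp add: d_def inner_commute[of y x] algebra_simps)
  \<comment> \<open>Adding (1 - \<eta>) / 2 times the identity for the squared norm turns convexity
    of \<open>G\<close> into the claim; abstracting the values leaves plain real arithmetic.\<close>
  moreover have "((1 - t) * X + t * Y - t * (1 - t) * D) / 2 + SP
      \<le> (1 - t) * (X / 2 + SX) + t * (Y / 2 + SY) - (1 - \<eta>) / 2 * t * (1 - t) * D"
    if "\<eta> / 2 * ((1 - t) * X + t * Y - t * (1 - t) * D) + SP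
      \<le> (1 - t) * (\<eta> / 2 * X + SX) + t * (\<eta> / 2 * Y + SY)" for X Y D SX SY SP
    using that by (simp add: field_simps)
  moreover have "norm (x - y) = norm d"
    by (simp add: d_def norm_minus_commute)
  ultimately show "std_quad ((1 - t) *\<^sub>R x + t *\<^sub>R y) + S ((1 - t) *\<^sub>R x + t *\<^sub>R y)
       \<le> (1 - t) * (std_quad x + S x) + t * (std_quad y + S y)
         - (1 - \<eta>) / 2 * t * (1 - t) * (norm (x - y))\<^sup>2"
    by (simp add: G_def std_quad_def power2_norm_eq_inner)
qed (use \<eta> in simp)

section \<open>Gradient and Hessian in coordinates\<close>

lemma linear_eq_inner_cart:
  fixes f :: "real^'n \<Rightarrow> real"
  assumes "linear f"
  shows "f v = (\<chi> i. f (axis i 1)) \<bullet> v"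
proof -
  have "v = (\<Sum>i\<in>UNIV. v $ i *\<^sub>R axis i 1)"
    using basis_expansion[of v] by (simp only: scalar_mult_eq_scaleR)
  then have "f v = f (\<Sum>i\<in>UNIV. v $ i *\<^sub>R axis i 1)" by (rule arg_cong)
  also have "\<dots> = (\<Sum>i\<in>UNIV. v $ i * f (axis i 1))"
    using assms by (simp add: linear_sum linear_scale)
  finally show ?thesis by (simp add: inner_vec_def mult.commute)
qed

lemma frechet_derivative_eq_grad:
  assumes "smooth f"
  shows "frechet_derivative f (at x) v = grad f x \<bullet> v"
  unfolding grad_def
  by (rule linear_eq_inner_cart[OF has_derivative_linear[OF smooth_has_derivative[OF assms]]])

lemma grad_has_derivative:
  assumes "smooth f"
  shows "(grad f has_derivative
    (\<lambda>v. \<chi> i. frechet_derivative (\<lambda>x. frechet_derivative f (at x) (axis i 1)) (at x) v)) (at x)"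
  by (subst has_derivative_componentwise_within)
    (auto simp: Basis_vec_def inner_axis grad_def
      intro!: smooth_has_derivative smooth_frechet_derivative assms)

lemma hessian_nth:
  assumes "smooth f"
  shows "hessian f x $ i $ j
    = frechet_derivative (\<lambda>x. frechet_derivative f (at x) (axis i 1)) (at x) (axis j 1)"
  unfolding hessian_def jacobian_def matrix_def
    frechet_derivative_at[OF grad_has_derivative[OF assms], symmetric] by simp

lemma frechet_derivative_add:
  fixes f g :: "'a::euclidean_space \<Rightarrow> real"
  assumes "smooth f" "smooth g"
  shows "frechet_derivative (\<lambda>x. f x + g x) (at x) v
    = frechet_derivative f (at x) v + frechet_derivative g (at x) v"
  by (rule fun_cong[OF frechet_derivative_at[OF has_derivative_add[OF
          smooth_has_derivative[OF assms(1)] smooth_has_derivative[OF assms(2)]], symmetric]])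

lemma hessian_std_quad_add:
  fixes S :: "real^'n \<Rightarrow> real"
  assumes S: "smooth S"
  shows "hessian (\<lambda>x. std_quad x + S x) x = mat 1 + hessian S x"
proof -
  have Q: "frechet_derivative std_quad (at x) v = x \<bullet> v" for x v :: "real^'n"
    by (rule fun_cong[OF frechet_derivative_at[OF std_quad_has_derivative, symmetric]])
  have lin: "frechet_derivative (\<lambda>x. x \<bullet> v) (at x) u = u \<bullet> v" for x u v :: "real^'n"
    by (rule fun_cong[OF frechet_derivative_at[OF
          has_derivative_inner_left[OF has_derivative_ident], symmetric]])
  have F: "smooth (\<lambda>x. std_quad x + S x)"
    by (rule smooth_add[OF smooth_std_quad S])
  have "hessian (\<lambda>x. std_quad x + S x) x $ i $ j = (mat 1 + hessian S x) $ i $ j" for i j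
  proof -
    have "hessian (\<lambda>x. std_quad x + S x) x $ i $ j
        = frechet_derivative (\<lambda>x. x \<bullet> axis i 1 + frechet_derivative S (at x) (axis i 1)) (at x) (axis j 1)"
      unfolding hessian_nth[OF F] frechet_derivative_add[OF smooth_std_quad S] Q ..
    also have "\<dots> = (axis j 1 :: real^'n) \<bullet> axis i 1 + hessian S x $ i $ j"
      unfolding frechet_derivative_add[OF smooth_inner smooth_frechet_derivative[OF S]] lin
        hessian_nth[OF S] ..
    also have "(axis j 1 :: real^'n) \<bullet> axis i 1 = (mat 1 :: real^'n^'n) $ i $ j"
      by (simp add: inner_axis_axis mat_def)
    finally show ?thesis by simp
  qed
  then show ?thesis by (simp add: vec_eq_iff)
qed

lemma minimizer_grad_eq_0:
  assumes "smooth F" "minimizer F z"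
  shows "grad F z = 0"
proof -
  have "\<forall>y\<in>UNIV. F z \<le> F y"
    using assms(2) by (auto simp: minimizer_def is_arg_min_def not_less)
  with differential_zero_maxmin[OF UNIV_I open_UNIV smooth_has_derivative[OF assms(1)]]
  have "frechet_derivative F (at z) = (\<lambda>v. 0)" by blast
  then show ?thesis by (simp add: grad_def vec_eq_iff)
qed

section \<open>BFGS with exact line search\<close>

lemma bfgs_step_decreasing:
  assumes "bfgs_step F x B x' B'"
  shows "F x' \<le> F x"
proof -
  obtain d \<alpha> where "exact_line_search F x d \<alpha>" "x' = x + \<alpha> *\<^sub>R d"
    using assms unfolding bfgs_step_def by blast
  then show ?thesis
    unfolding exact_line_search_def is_arg_min_def
    by (metis add.right_neutral linorder_le_less_linear order_refl scale_zero_left)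
qed

text \<open>Near \<open>z\<close> the excess \<open>F y - F z\<close> lies between two multiples of
  the squared distance: strong convexity gives the lower one, a Lipschitz-type bound on the gradient
  at \<open>z\<close> the upper one. Monotonicity of \<open>F\<close> along the run links
  consecutive distances.\<close>

lemma q_order_at_least_1_of_bfgs_sequence:
  fixes F :: "real^'n \<Rightarrow> real"
  assumes "bfgs_sequence_to F x z"
  shows "q_order_at_least x z 1"
proof -
  from assms obtain x0 B0 B where F: "smooth F" "strongly_convex F" "minimizer F z"
    and run: "bfgs_run F x0 B0 x B" and nonterm: "nonterminating F x" and lim: "x \<longlonglongrightarrow> z"
    unfolding bfgs_sequence_to_def by blast
  have grad_z: "grad F z = 0" by (rule minimizer_grad_eq_0[OF F(1,3)])
  have neq: "x k \<noteq> z" for k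
    using nonterm grad_z by (auto simp: nonterminating_def)
  have decr: "F (x (Suc k)) \<le> F (x k)" for k
    using run bfgs_step_decreasing unfolding bfgs_run_def by blast
  obtain m where m: "m > 0" and first_order: "\<And>u v f'. (F has_derivative f') (at u) \<Longrightarrow>
      F u + f' (v - u) + m / 2 * (norm (v - u))\<^sup>2 \<le> F v"
    using strongly_convex_obtain[OF F(2)] by blast
  have first_order': "F u + grad F u \<bullet> (v - u) + m / 2 * (norm (v - u))\<^sup>2 \<le> F v" for u v
    using first_order[OF smooth_has_derivative[OF F(1)], of u v]
    by (simp only: frechet_derivative_eq_grad[OF F(1)])
  obtain A where A: "(grad F has_derivative A) (at z)"
    using grad_has_derivative[OF F(1)] by blast
  obtain L where L: "L > 0" "\<And>v. norm (A v) \<le> norm v * L"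
    using bounded_linear.pos_bounded[OF has_derivative_bounded_linear[OF A]] by blast
  \<comment> \<open>Tolerance 1 in the definition of the derivative of the gradient at
    \<open>z\<close> is what adds 1 to \<open>L\<close> below.\<close>
  obtain d where d: "d > 0" "\<And>y. norm (y - z) < d \<Longrightarrow>
      norm (grad F y - grad F z - A (y - z)) \<le> 1 * norm (y - z)"
    using A unfolding has_derivative_at_alt by (metis zero_less_one)
  have grad_le: "norm (grad F y) \<le> (L + 1) * norm (y - z)" if "norm (y - z) < d" for y
  proof -
    have "norm (grad F y) \<le> norm (grad F y - A (y - z)) + norm (A (y - z))"
      using norm_triangle_sub[of "grad F y" "A (y - z)"] by simp
    with d(2)[OF that] L(2)[of "y - z"] show ?thesis
      by (simp add: grad_z algebra_simps)
  qed
  have upper: "F y - F z \<le> (L + 1) * (norm (y - z))\<^sup>2" if "norm (y - z) < d" for y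
  proof -
    \<comment> \<open>Based at \<open>y\<close> instead of \<open>z\<close>, the first-order
      inequality bounds the excess from above.\<close>
    have "F y - F z \<le> grad F y \<bullet> (y - z) - m / 2 * (norm (z - y))\<^sup>2"
      using first_order'[of y z] by (simp add: inner_diff_right)
    also have "\<dots> \<le> grad F y \<bullet> (y - z)" using m by simp
    also have "\<dots> \<le> norm (grad F y) * norm (y - z)" by (rule norm_cauchy_schwarz)
    also have "\<dots> \<le> (L + 1) * norm (y - z) * norm (y - z)"
      using grad_le[OF that] by (rule mult_right_mono) simp
    finally show ?thesis by (simp only: power2_eq_square mult.assoc)
  qed
  have lower: "m / 2 * (norm (y - z))\<^sup>2 \<le> F y - F z" for y
    using first_order'[of z y] by (simp add: grad_z)
  define C where "C = sqrt (2 * (L + 1) / m)"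
  have C: "C > 0" using L(1) m by (simp add: C_def)
  obtain k0 where k0: "\<And>k. k \<ge> k0 \<Longrightarrow> norm (x k - z) < d"
    using LIMSEQ_D[OF lim d(1)] by blast
  have "norm (x (Suc k) - z) \<le> C * norm (x k - z) powr 1" if "k \<ge> k0" for k
  proof -
    have "m / 2 * (norm (x (Suc k) - z))\<^sup>2 \<le> (L + 1) * (norm (x k - z))\<^sup>2"
      using lower[of "x (Suc k)"] decr[of k] upper[OF k0[OF that]] by linarith
    then have "(norm (x (Suc k) - z))\<^sup>2 \<le> 2 * (L + 1) / m * (norm (x k - z))\<^sup>2"
      using m by (simp add: field_simps)
    then have "sqrt ((norm (x (Suc k) - z))\<^sup>2) \<le> sqrt (2 * (L + 1) / m * (norm (x k - z))\<^sup>2)"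
      by (rule real_sqrt_le_mono)
    also have "\<dots> = C * norm (x k - z)"
      unfolding C_def real_sqrt_mult by simp
    finally show ?thesis by simp
  qed
  with C lim neq show ?thesis
    unfolding q_order_at_least_def by (intro conjI exI[of _ C] exI[of _ k0]) auto
qed

lemma has_q_order_of_bfgs_sequence:
  assumes "bfgs_sequence_to F x z"
  shows "has_q_order x z" "1 \<le> q_order x z"
proof -
  note 1 = q_order_at_least_1_of_bfgs_sequence[OF assms]
  then show "has_q_order x z" unfolding has_q_order_def by blast
  have "ereal 1 \<le> q_order x z"
    unfolding q_order_def using 1 by (intro SUP_upper) simp
  then show "1 \<le> q_order x z" by (simp add: one_ereal_def)
qed

section \<open>The BFGS update and uniqueness of a step\<close>

lemma outer_mult_vec: "outer u v *v w = (v \<bullet> w) *\<^sub>R u"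
  by (simp add: vec_eq_iff outer_def matrix_vector_mult_def inner_vec_def sum_distrib_left mult_ac)

lemma bfgs_update_mult_vec:
  "bfgs_update B s y *v v
    = B *v v - ((s \<bullet> (B *v v)) / (s \<bullet> (B *v s))) *\<^sub>R (B *v s) + ((y \<bullet> v) / (s \<bullet> y)) *\<^sub>R y"
  by (simp add: bfgs_update_def matrix_vector_mult_add_rdistrib matrix_vector_mult_diff_rdistrib
      scaleR_matrix_vector_assoc[symmetric] matrix_vector_mul_assoc[symmetric] outer_mult_vec
      matrix_vector_mult_scaleR divide_inverse mult.commute)

lemma transpose_eq_iff:
  fixes A :: "real^'n^'n"
  shows "transpose A = A \<longleftrightarrow> (\<forall>u v. u \<bullet> (A *v v) = (A *v u) \<bullet> v)"
proof -
  have adj: "u \<bullet> (A *v v) = (transpose A *v u) \<bullet> v" for u v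
    unfolding transpose_matrix_vector by (rule dot_lmul_matrix[symmetric])
  show ?thesis
    unfolding adj matrix_eq by (auto simp only: vector_eq_rdot)
qed

text \<open>If \<open>w\<close> is \<open>v\<close> minus its B-orthogonal projection onto
  \<open>s\<close>, the new quadratic form at \<open>v\<close> is the old one at \<open>w\<close>
  plus (y . v)^2 / (s . y). When \<open>w\<close> vanishes, \<open>v\<close> is a nonzero multiple
  of \<open>s\<close> and the second term is positive.\<close>

lemma sym_pos_def_bfgs_update:
  fixes B :: "real^'n^'n"
  assumes B: "sym_pos_def B" and sy: "0 < s \<bullet> y"
  shows "sym_pos_def (bfgs_update B s y)"
proof -
  have sym: "u \<bullet> (B *v v) = (B *v u) \<bullet> v" for u v
    using B transpose_eq_iff[of B] by (simp add: sym_pos_def_def)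
  have swap: "u \<bullet> (B *v v) = v \<bullet> (B *v u)" for u v
    by (subst sym) (rule inner_commute)
  have pos: "v \<noteq> 0 \<Longrightarrow> 0 < v \<bullet> (B *v v)" for v
    using B by (simp add: sym_pos_def_def pos_def_def)
  have "s \<noteq> 0" using sy by auto
  then have sBs: "0 < s \<bullet> (B *v s)" by (rule pos)
  have "transpose (bfgs_update B s y) = bfgs_update B s y"
    unfolding transpose_eq_iff bfgs_update_mult_vec
  proof (intro allI)
    fix u v
    show "u \<bullet> (B *v v - (s \<bullet> (B *v v) / (s \<bullet> (B *v s))) *\<^sub>R (B *v s) + (y \<bullet> v / (s \<bullet> y)) *\<^sub>R y)
      = (B *v u - (s \<bullet> (B *v u) / (s \<bullet> (B *v s))) *\<^sub>R (B *v s) + (y \<bullet> u / (s \<bullet> y)) *\<^sub>R y) \<bullet> v"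
      using swap[of u s] swap[of v s] swap[of u v]
      by (simp add: inner_diff_left inner_diff_right inner_add_left inner_add_right
          inner_commute[of _ v] inner_commute[of u y] mult.commute)
  qed
  moreover have "0 < v \<bullet> (bfgs_update B s y *v v)" if "v \<noteq> 0" for v
  proof -
    define t where "t = (s \<bullet> (B *v v)) / (s \<bullet> (B *v s))"
    define w where "w = v - t *\<^sub>R s"
    have t: "t * (s \<bullet> (B *v s)) = s \<bullet> (B *v v)"
      using sBs by (simp add: t_def)
    have vBs: "v \<bullet> (B *v s) = s \<bullet> (B *v v)"
      by (rule swap)
    have "w \<bullet> (B *v w) = v \<bullet> (B *v v) - t * (s \<bullet> (B *v v))"
      using t vBs by (simp add: w_def matrix_vector_mult_diff_distrib matrix_vector_mult_scaleR
          inner_diff_left inner_diff_right)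
    moreover have "v \<bullet> (bfgs_update B s y *v v)
        = v \<bullet> (B *v v) - t * (v \<bullet> (B *v s)) + (y \<bullet> v) / (s \<bullet> y) * (v \<bullet> y)"
      by (simp add: bfgs_update_mult_vec inner_diff_right inner_add_right t_def)
    ultimately have eq: "v \<bullet> (bfgs_update B s y *v v) = w \<bullet> (B *v w) + (y \<bullet> v)\<^sup>2 / (s \<bullet> y)"
      by (simp add: vBs inner_commute[of v y] power2_eq_square)
    show ?thesis
    proof (cases "w = 0")
      case True
      then have "v = t *\<^sub>R s" by (simp add: w_def)
      with \<open>v \<noteq> 0\<close> sy have "y \<bullet> v \<noteq> 0" by (auto simp: inner_commute)
      with sy True show ?thesis by (simp add: eq)
    next
      case False
      have "0 \<le> (y \<bullet> v)\<^sup>2 / (s \<bullet> y)" using sy by simp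
      with pos[OF False] show ?thesis by (simp add: eq)
    qed
  qed
  ultimately show ?thesis by (simp add: sym_pos_def_def pos_def_def)
qed

lemma sym_pos_def_mat_1: "sym_pos_def (mat 1)"
  by (simp add: sym_pos_def_def pos_def_def)

text \<open>By strong convexity a stationary point on the line is the strict minimizer along it, and
  \<open>0 \<le> \<beta>\<close> places it on the ray. So the step length is unique.\<close>

lemma exact_line_search_iff:
  assumes F: "smooth F" "strongly_convex F" and d: "d \<noteq> 0"
    and \<beta>: "0 \<le> \<beta>" "grad F (x + \<beta> *\<^sub>R d) \<bullet> d = 0"
  shows "exact_line_search F x d \<alpha> \<longleftrightarrow> \<alpha> = \<beta>"
proof -
  obtain m where m: "m > 0" and first_order: "\<And>x y f'. (F has_derivative f') (at x) \<Longrightarrow>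
      F x + f' (y - x) + m / 2 * (norm (y - x))\<^sup>2 \<le> F y"
    using strongly_convex_obtain[OF F(2)] by blast
  have less: "F (x + \<beta> *\<^sub>R d) < F (x + t *\<^sub>R d)" if "t \<noteq> \<beta>" for t
  proof -
    have "x + t *\<^sub>R d - (x + \<beta> *\<^sub>R d) = (t - \<beta>) *\<^sub>R d"
      by (simp add: algebra_simps)
    then have "F (x + \<beta> *\<^sub>R d) + m / 2 * (norm ((t - \<beta>) *\<^sub>R d))\<^sup>2 \<le> F (x + t *\<^sub>R d)"
      using first_order[OF smooth_has_derivative[OF F(1)], of "x + \<beta> *\<^sub>R d" "x + t *\<^sub>R d"] \<beta>(2)
      by (simp add: frechet_derivative_eq_grad[OF F(1)])
    moreover have "0 < m / 2 * (norm ((t - \<beta>) *\<^sub>R d))\<^sup>2"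
      using m d that by simp
    ultimately show ?thesis by linarith
  qed
  then have "F (x + \<beta> *\<^sub>R d) \<le> F (x + t *\<^sub>R d)" for t
    by (cases "t = \<beta>") (auto intro: less_imp_le)
  with less \<beta>(1) show ?thesis
    unfolding exact_line_search_def is_arg_min_def by (force simp: not_less)
qed

lemma pos_def_mult_cancel:
  assumes "pos_def B" "B *v u = B *v v"
  shows "u = v"
proof (rule ccontr)
  assume "u \<noteq> v"
  then have "0 < (u - v) \<bullet> (B *v (u - v))"
    using assms(1) by (simp add: pos_def_def)
  with assms(2) show False by (simp add: matrix_vector_mult_diff_distrib)
qed

text \<open>Positive definiteness makes the search direction unique, namely \<open>s\<close> divided
  by \<mu>; the exact step length along it is then \<mu>.\<close>

lemma bfgs_step_iff:
  assumes F: "smooth F" "strongly_convex F" and B: "pos_def B"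
    and s: "s \<noteq> 0" "0 < \<mu>" "B *v s = - (\<mu> *\<^sub>R grad F x)" "grad F (x + s) \<bullet> s = 0"
  shows "bfgs_step F x B x' B' \<longleftrightarrow>
    x' = x + s \<and> B' = bfgs_update B s (grad F (x + s) - grad F x)"
proof -
  define d where "d = s /\<^sub>R \<mu>"
  have "B *v d = - grad F x"
    using s(2,3) by (simp add: d_def matrix_vector_mult_scaleR)
  then have dir: "B *v e = - grad F x \<longleftrightarrow> e = d" for e
    using pos_def_mult_cancel[OF B, of e d] by auto
  have "exact_line_search F x d \<alpha> \<longleftrightarrow> \<alpha> = \<mu>" for \<alpha>
    using s by (intro exact_line_search_iff[OF F]) (auto simp: d_def)
  then show ?thesis
    unfolding bfgs_step_def dir using s(2) by (auto simp: d_def)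
qed

text \<open>The conditions speak of points and gradients only, not of the matrices. The second
  condition on \<open>P\<close> expresses that its dimension is at most two: vectors orthogonal to a
  common nonzero vector are parallel. Steepest descent in the first step matches the identity as
  initial matrix.\<close>

locale planar_bfgs =
  fixes F :: "real^'n \<Rightarrow> real" and X :: "nat \<Rightarrow> real^'n" and P :: "(real^'n) set"
  assumes F: "smooth F" "strongly_convex F"
    and P: "subspace P"
      "\<And>u v w. u \<in> P \<Longrightarrow> v \<in> P \<Longrightarrow> w \<in> P \<Longrightarrow> v \<noteq> 0 \<Longrightarrow> w \<noteq> 0 \<Longrightarrow> u \<bullet> w = 0 \<Longrightarrow> v \<bullet> w = 0 \<Longrightarrow>
        \<exists>c. u = c *\<^sub>R v"
    and X_mem: "X k \<in> P" and grad_mem: "grad F (X k) \<in> P"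
    and exact: "grad F (X (Suc k)) \<bullet> (X (Suc k) - X k) = 0"
    and conjugate: "(X (Suc (Suc k)) - X (Suc k)) \<bullet> (grad F (X (Suc k)) - grad F (X k)) = 0"
    and descent: "grad F (X k) \<bullet> (X (Suc k) - X k) < 0"
    and steepest: "\<exists>\<mu>>0. X 1 - X 0 = - (\<mu> *\<^sub>R grad F (X 0))"
begin

abbreviation step where "step k \<equiv> X (Suc k) - X k"
abbreviation gdiff where "gdiff k \<equiv> grad F (X (Suc k)) - grad F (X k)"

primrec H :: "nat \<Rightarrow> real^'n^'n" where
  "H 0 = mat 1"
| "H (Suc k) = bfgs_update (H k) (step k) (gdiff k)"

lemma curvature: "0 < step k \<bullet> gdiff k"
  using exact[of k] descent[of k] by (simp add: inner_diff_right inner_commute)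

lemma step_neq_0: "step k \<noteq> 0"
  using descent[of k] by auto

lemma step_mem: "step k \<in> P" and gdiff_mem: "gdiff k \<in> P"
  using X_mem grad_mem P(1) by (auto intro: subspace_diff)

text \<open>The new direction is determined up to sign: the secant equation turns the conjugacy
  of \<open>step (k + 1)\<close> and \<open>gdiff k\<close> into orthogonality of \<open>H (k + 1) step (k + 1)\<close> and \<open>step k\<close>, and in a plane
  only multiples of the gradient are orthogonal to \<open>step k\<close>.\<close>

lemma H_invariant:
  "sym_pos_def (H k) \<and> (\<forall>v\<in>P. H k *v v \<in> P) \<and> (\<exists>\<mu>>0. H k *v step k = - (\<mu> *\<^sub>R grad F (X k)))"
proof (induction k)
  case 0
  then show ?case using steepest by (simp add: sym_pos_def_mat_1)
next
  case (Suc k)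
  have spd: "sym_pos_def (H (Suc k))"
    using Suc curvature by (simp add: sym_pos_def_bfgs_update)
  \<comment> \<open>Invariance of the plane is carried along so that the image of the next step
    stays where orthogonality determines it up to a factor.\<close>
  have mem: "H (Suc k) *v v \<in> P" if "v \<in> P" for v
  proof -
    have "H k *v v \<in> P" "H k *v step k \<in> P" using Suc that step_mem by auto
    then show ?thesis
      unfolding H.simps bfgs_update_mult_vec
      by (intro subspace_add[OF P(1) subspace_diff[OF P(1) _ subspace_scale[OF P(1)]]
          subspace_scale[OF P(1) gdiff_mem]])
  qed
  have "0 < step k \<bullet> (H k *v step k)"
    using Suc step_neq_0 by (simp add: sym_pos_def_def pos_def_def)
  then have secant: "H (Suc k) *v step k = gdiff k"
    using curvature[of k] by (simp add: bfgs_update_mult_vec inner_commute)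
  let ?w = "H (Suc k) *v step (Suc k)" and ?g = "grad F (X (Suc k))"
  have "?w \<bullet> step k = 0"
  proof -
    have "step k \<bullet> ?w = (H (Suc k) *v step k) \<bullet> step (Suc k)"
      using spd unfolding sym_pos_def_def transpose_eq_iff by blast
    then show ?thesis
      unfolding secant using conjugate[of k] by (simp only: inner_commute)
  qed
  moreover have "?g \<noteq> 0" using descent[of "Suc k"] by auto
  ultimately have "\<exists>c. ?w = c *\<^sub>R ?g"
    by (intro P(2)[OF mem[OF step_mem] grad_mem step_mem _ step_neq_0 _ exact])
  then obtain c where c: "?w = c *\<^sub>R ?g" by blast
  \<comment> \<open>Positive definiteness fixes the sign of \<open>c\<close>, because the step is a
    descent direction.\<close>
  have "0 < step (Suc k) \<bullet> ?w"
    using spd step_neq_0 by (simp add: sym_pos_def_def pos_def_def del: H.simps)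
  then have "0 < - c"
    using descent[of "Suc k"] unfolding c by (simp add: zero_less_mult_iff inner_commute)
  then have "\<exists>\<mu>>0. ?w = - (\<mu> *\<^sub>R ?g)"
    by (intro exI[of _ "- c"]) (simp add: c del: H.simps)
  with spd mem show ?case by (intro conjI ballI)
qed

lemma step_iff: "bfgs_step F (X k) (H k) x B \<longleftrightarrow> x = X (Suc k) \<and> B = H (Suc k)"
proof -
  obtain \<mu> where "0 < \<mu>" "H k *v step k = - (\<mu> *\<^sub>R grad F (X k))"
    using H_invariant by blast
  from bfgs_step_iff[OF F _ step_neq_0 this] show ?thesis
    using H_invariant[of k] exact by (simp add: sym_pos_def_def)
qed

text \<open>Every step is forced, so claims about all runs need only be checked on \<open>X\<close>
  and \<open>H\<close>.\<close>

lemma run_iff: "bfgs_run F (X 0) (mat 1) x B \<longleftrightarrow> x = X \<and> B = H"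
proof
  assume run: "bfgs_run F (X 0) (mat 1) x B"
  have "x k = X k \<and> B k = H k" for k
  proof (induction k)
    case 0
    then show ?case using run by (simp add: bfgs_run_def)
  next
    case (Suc k)
    have "bfgs_step F (x k) (B k) (x (Suc k)) (B (Suc k))"
      using run by (simp add: bfgs_run_def)
    then show ?case by (simp only: Suc step_iff)
  qed
  then show "x = X \<and> B = H" by auto
next
  assume "x = X \<and> B = H"
  then show "bfgs_run F (X 0) (mat 1) x B"
    using step_iff sym_pos_def_mat_1 by (simp add: bfgs_run_def del: H.simps(2))
qed

end

section \<open>Iterates in the complex plane\<close>

lemma norm_add_i_bounds:
  fixes t :: real
  shows "1 \<le> cmod (of_real t + \<i>)" "cmod (of_real t + \<i>) \<le> 1 + \<bar>t\<bar>"
proof -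
  show "1 \<le> cmod (of_real t + \<i>)"
    using abs_Im_le_cmod[of "of_real t + \<i>"] by simp
  show "cmod (of_real t + \<i>) \<le> 1 + \<bar>t\<bar>"
    using norm_triangle_ineq[of "of_real t" \<i>] by simp
qed

lemma add_i_neq_0: "of_real t + \<i> \<noteq> (0 :: complex)"
  using norm_add_i_bounds(1)[of t] by auto

lemma power_le_self:
  fixes t :: real
  assumes "0 \<le> t" "t \<le> 1" "n \<ge> 1"
  shows "t ^ n \<le> t"
  using power_decreasing[OF assms(3,1,2)] by simp

text \<open>After extracting a common factor \<open>h\<close>, orthogonality becomes the vanishing
  of a real part; direction and size of the gradient drop out.\<close>

lemma complex_inner_mult_right_self:
  fixes u v h :: complex
  shows "(u * h) \<bullet> (v * h) = Re (u * cnj v) * (cmod h)\<^sup>2"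
proof -
  have "(u * h) \<bullet> (v * h) = Re (u * cnj v * (h * cnj h))"
    by (simp add: inner_complex_def algebra_simps)
  then show ?thesis by (simp only: complex_norm_square[symmetric] of_real_power[symmetric]) simp
qed

text \<open>Orthogonality to \<open>w\<close> means that the quotient by \<open>w\<close> is purely
  imaginary, and nonzero imaginary numbers are real multiples of each other.\<close>

lemma complex_orthogonal_parallel:
  fixes u v w :: complex
  assumes "v \<noteq> 0" "w \<noteq> 0" "u \<bullet> w = 0" "v \<bullet> w = 0"
  shows "\<exists>c. u = of_real c * v"
proof -
  have eq: "t = of_real (Im (t / w)) * \<i> * w" if "t \<bullet> w = 0" for t
  proof -
    have "Re (t / w) = 0" using that by (simp add: Re_divide inner_complex_def)
    then have "t / w = of_real (Im (t / w)) * \<i>" by (simp add: complex_eq_iff)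
    then show ?thesis using assms(2) by (simp add: field_simps)
  qed
  let ?u = "Im (u / w)" and ?v = "Im (v / w)"
  have "?v \<noteq> 0" using eq[OF assms(4)] assms(1) by auto
  then have "u = of_real (?u / ?v) * v"
    by (subst eq[OF assms(3)], subst (2) eq[OF assms(4)]) simp
  then show ?thesis by blast
qed

locale iterate_parameters =
  fixes \<delta> \<gamma> :: real
  assumes \<delta>: "0 < \<delta>" "\<delta> \<le> 1 / 16" and \<gamma>: "0 < \<gamma>" "\<gamma> \<le> 1"
begin

text \<open>The state consists of \<open>b (k - 1)\<close>, \<open>b k\<close> and the gradient \<open>g k\<close>, where the plane of the
  iterates is identified with the complex numbers.\<close>

primrec state :: "nat \<Rightarrow> real \<times> real \<times> complex" where
  "state 0 = (0, \<delta>, of_real \<gamma>)"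
| "state (Suc k) = (case state k of (p, b, g) \<Rightarrow>
     let g' = g * of_real (p + b) / (of_real p + \<i>)
     in (b, if even k then - b + b ^ (k + 2) else (cmod g' * \<bar>b\<bar> / 4) ^ (k + 2), g'))"

definition p where "p k = fst (state k)"
definition b where "b k = fst (snd (state k))"
definition g where "g k = snd (snd (state k))"
definition z where "z k = of_real (p k + b k) / (of_real (p k) + \<i>)"
definition x where "x k = (1 - \<i> * of_real (b k)) * g k"

lemma p_0: "p 0 = 0" and b_0: "b 0 = \<delta>" and g_0: "g 0 = of_real \<gamma>"
  by (simp_all add: p_def b_def g_def)

lemma p_Suc: "p (Suc k) = b k"
  by (simp add: p_def b_def Let_def split_beta)

lemma g_Suc: "g (Suc k) = z k * g k"
  by (simp add: p_def b_def g_def z_def Let_def split_beta)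

lemma b_Suc: "b (Suc k) =
    (if even k then - b k + b k ^ (k + 2) else (cmod (g (Suc k)) * \<bar>b k\<bar> / 4) ^ (k + 2))"
  by (simp add: p_def b_def g_def Let_def split_beta)

section \<open>Size estimates for the parameters and the gradients\<close>

lemma norm_z_le: "cmod (z k) \<le> \<bar>p k + b k\<bar>"
  using norm_add_i_bounds(1)[of "p k"]
  by (simp add: z_def norm_divide divide_le_eq mult_le_cancel_left1 del: of_real_add)

lemma norm_z_ge: "\<bar>p k\<bar> \<le> 1 \<Longrightarrow> \<bar>p k + b k\<bar> / 2 \<le> cmod (z k)"
proof -
  assume "\<bar>p k\<bar> \<le> 1"
  then have "\<bar>p k + b k\<bar> / 2 \<le> \<bar>p k + b k\<bar> / cmod (of_real (p k) + \<i>)"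
    using norm_add_i_bounds[of "p k"] by (intro divide_left_mono mult_pos_pos) auto
  then show ?thesis by (simp add: z_def norm_divide del: of_real_add)
qed

lemma z_neq_0: "p k + b k \<noteq> 0 \<Longrightarrow> z k \<noteq> 0"
  using norm_add_i_bounds(1)[of "p k"] by (auto simp: z_def simp del: of_real_add)

lemma norm_g_Suc: "cmod (g (Suc k)) = cmod (z k) * cmod (g k)"
  by (simp add: g_Suc norm_mult)

text \<open>This is the cancelling step: the sum that governs the next ratio collapses to
  \<open>b k ^ (k + 2)\<close>. That remainder is at most \<open>b k / 16\<close>, so the new
  parameter is still comparable to \<open>- b k\<close>.\<close>

lemma b_Suc_even:
  assumes "even k" "0 < b k" "b k \<le> 1 / 16"
  shows "- b k \<le> b (Suc k)" "b (Suc k) \<le> - (b k / 2)"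
    "p (Suc k) + b (Suc k) = b k ^ (k + 2)" "b k ^ (k + 2) \<le> 1 / 16"
proof -
  have "b k ^ (k + 2) = b k * b k ^ (k + 1)" by simp
  also have "\<dots> \<le> b k * b k"
    using assms by (intro mult_left_mono power_le_self) auto
  also have "\<dots> \<le> b k * (1 / 16)" using assms by (intro mult_left_mono) auto
  finally have "b k ^ (k + 2) \<le> b k * (1 / 16)" .
  moreover have "0 < b k ^ (k + 2)" using assms(2) by (rule zero_less_power)
  ultimately show "- b k \<le> b (Suc k)" "b (Suc k) \<le> - (b k / 2)"
    "p (Suc k) + b (Suc k) = b k ^ (k + 2)" "b k ^ (k + 2) \<le> 1 / 16"
    using assms by (auto simp: b_Suc p_Suc simp del: power_Suc add_2_eq_Suc')
qed

text \<open>The divisor 4 in the recursion keeps the new parameter below a quarter of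
  \<open>\<bar>b k\<bar>\<close>. Hence it cannot cancel \<open>b k\<close>: the sum keeps its sign
  and at least half of its size.\<close>

lemma b_Suc_odd:
  assumes "odd k" "b k < 0" "- (1 / 16) \<le> b k" "g (Suc k) \<noteq> 0" "cmod (g (Suc k)) \<le> 1"
  shows "0 < b (Suc k)" "b (Suc k) \<le> - (b k) / 4"
    "p (Suc k) + b (Suc k) \<le> b k / 2" "b k \<le> p (Suc k) + b (Suc k)"
proof -
  have eq: "b (Suc k) = (cmod (g (Suc k)) * \<bar>b k\<bar> / 4) ^ (k + 2)"
    using assms by (simp add: b_Suc)
  show pos: "0 < b (Suc k)"
    unfolding eq using assms by (intro zero_less_power divide_pos_pos mult_pos_pos) auto
  have "cmod (g (Suc k)) * \<bar>b k\<bar> \<le> 1 * \<bar>b k\<bar>"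
    using assms by (intro mult_right_mono) auto
  moreover have "(cmod (g (Suc k)) * \<bar>b k\<bar> / 4) ^ (k + 2) \<le> cmod (g (Suc k)) * \<bar>b k\<bar> / 4"
  proof (rule power_le_self)
    have "\<bar>b k\<bar> \<le> 1 / 16" using assms by simp
    with calculation show "cmod (g (Suc k)) * \<bar>b k\<bar> / 4 \<le> 1" by linarith
  qed simp_all
  ultimately show "b (Suc k) \<le> - (b k) / 4"
    unfolding eq using assms by linarith
  with pos show "p (Suc k) + b (Suc k) \<le> b k / 2" "b k \<le> p (Suc k) + b (Suc k)"
    using assms by (auto simp: p_Suc)
qed

text \<open>The signs of the parameters have period two, so the induction advances two steps at a
  time and gains a factor 4 from the second of them. The bounds on \<open>p + b\<close> keep the
  gradients nonzero and of norm at most 1.\<close>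

lemma invariant_even:
  "0 < b (2 * j) \<and> b (2 * j) \<le> \<delta> / 4 ^ j \<and> g (2 * j) \<noteq> 0 \<and> cmod (g (2 * j)) \<le> 1 \<and>
   \<bar>p (2 * j)\<bar> \<le> 1 / 16 \<and> p (2 * j) + b (2 * j) \<noteq> 0 \<and> \<bar>p (2 * j) + b (2 * j)\<bar> \<le> 1 / 16"
proof (induction j)
  case 0
  then show ?case using \<delta> \<gamma> by (simp add: p_0 b_0 g_0)
next
  case (Suc j)
  let ?k = "2 * j"
  have "\<delta> / 4 ^ j \<le> \<delta>" using \<delta> by (simp add: divide_le_eq mult_le_cancel_left1)
  with Suc \<delta> have b: "0 < b ?k" "b ?k \<le> 1 / 16" by linarith+
  have z: "z ?k \<noteq> 0" "cmod (z ?k) \<le> 1"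
    using Suc z_neq_0 norm_z_le[of ?k] by auto
  have g': "g (Suc ?k) \<noteq> 0" "cmod (g (Suc ?k)) \<le> 1"
    using Suc z by (simp_all add: g_Suc norm_mult mult_le_one)
  have "0 < b ?k ^ (?k + 2)" using b(1) by (rule zero_less_power)
  then have z': "z (Suc ?k) \<noteq> 0" "cmod (z (Suc ?k)) \<le> 1"
    using b_Suc_even[OF _ b] norm_z_le[of "Suc ?k"]
    by (auto intro!: z_neq_0 simp del: power_Suc add_2_eq_Suc')
  have g'': "g (Suc (Suc ?k)) \<noteq> 0" "cmod (g (Suc (Suc ?k))) \<le> 1"
    using g' z' by (simp_all add: g_Suc[of "Suc ?k"] norm_mult mult_le_one)
  have "b (Suc ?k) < 0" "- (1 / 16) \<le> b (Suc ?k)"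
    using b_Suc_even(1,2)[OF _ b] b by auto
  note b'' = b_Suc_odd[OF _ this g'', simplified]
  have "b (Suc (Suc ?k)) \<le> \<delta> / 4 ^ Suc j"
    using b''(2) b_Suc_even(1)[OF _ b] Suc by auto
  moreover have "p (Suc (Suc ?k)) = b (Suc ?k)" by (rule p_Suc)
  ultimately show ?case
    using b'' g'' \<open>b (Suc ?k) < 0\<close> \<open>- (1 / 16) \<le> b (Suc ?k)\<close> by auto
qed

text \<open>The bound on \<open>b k\<close> is written in the form needed for index
  \<open>k + 1\<close>: for even \<open>k\<close> the next parameter is at most \<open>b k\<close>
  in absolute value.\<close>

lemma even_bounds:
  assumes "even k"
  shows "0 < b k" "b k \<le> 2 * \<delta> / 2 ^ k / 2" "b k \<le> 1 / 16" "g k \<noteq> 0" "cmod (g k) \<le> 1"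
    "\<bar>p k\<bar> \<le> 1 / 16" "p k + b k \<noteq> 0" "\<bar>p k + b k\<bar> \<le> 1 / 16"
proof -
  obtain j where k: "k = 2 * j" using assms by auto
  note inv = invariant_even[of j, folded k]
  have *: "(2::real) ^ k = 4 ^ j" by (simp add: k power_mult)
  have "\<delta> / 4 ^ j \<le> \<delta>" using \<delta> by (simp add: divide_le_eq mult_le_cancel_left1)
  with inv \<delta> show "b k \<le> 1 / 16" by linarith
  show "0 < b k" "b k \<le> 2 * \<delta> / 2 ^ k / 2" "g k \<noteq> 0" "cmod (g k) \<le> 1"
    "\<bar>p k\<bar> \<le> 1 / 16" "p k + b k \<noteq> 0" "\<bar>p k + b k\<bar> \<le> 1 / 16"
    using inv * by auto
qed

lemma bounds:
  shows "\<bar>b k\<bar> \<le> 2 * \<delta> / 2 ^ k" "\<bar>b k\<bar> \<le> 1 / 16" "g k \<noteq> 0" "cmod (g k) \<le> 1"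
    "\<bar>p k\<bar> \<le> 1 / 16" "p k + b k \<noteq> 0" "\<bar>p k + b k\<bar> \<le> 1 / 16"
proof -
  have "\<bar>b k\<bar> \<le> 2 * \<delta> / 2 ^ k \<and> \<bar>b k\<bar> \<le> 1 / 16 \<and> g k \<noteq> 0 \<and> cmod (g k) \<le> 1 \<and>
    \<bar>p k\<bar> \<le> 1 / 16 \<and> p k + b k \<noteq> 0 \<and> \<bar>p k + b k\<bar> \<le> 1 / 16"
  proof (cases "even k")
    case True
    from even_bounds[OF this] show ?thesis by auto
  next
    case False
    then obtain l where k: "k = Suc l" and l: "even l" by (cases k) auto
    note e = even_bounds[OF l]
    note o = b_Suc_even[OF l e(1,3)]
    have "0 < b l ^ (l + 2)" using e(1) by (rule zero_less_power)
    moreover have "2 * \<delta> / 2 ^ k = 2 * \<delta> / 2 ^ l / 2" by (simp add: k)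
    moreover have "g k \<noteq> 0" "cmod (g k) \<le> 1"
      using e z_neq_0[OF e(7)] norm_z_le[of l] by (simp_all add: k g_Suc norm_mult mult_le_one)
    moreover have "p k = b l" by (simp add: k p_Suc)
    ultimately show ?thesis
      using e o unfolding k by auto
  qed
  then show "\<bar>b k\<bar> \<le> 2 * \<delta> / 2 ^ k" "\<bar>b k\<bar> \<le> 1 / 16" "g k \<noteq> 0" "cmod (g k) \<le> 1"
    "\<bar>p k\<bar> \<le> 1 / 16" "p k + b k \<noteq> 0" "\<bar>p k + b k\<bar> \<le> 1 / 16" by auto
qed

lemma norm_z_le_16: "cmod (z k) \<le> 1 / 16"
  using norm_z_le[of k] bounds(7)[of k] by simp

lemma norm_z_ge': "\<bar>p k + b k\<bar> / 2 \<le> cmod (z k)"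
  using norm_z_ge[of k] bounds(5)[of k] by simp

lemma norm_g_Suc_le: "cmod (g (Suc k)) \<le> cmod (g k) / 16"
  using mult_right_mono[OF norm_z_le_16, of "cmod (g k)" k] by (simp add: norm_g_Suc)

lemma norm_g_add_le: "cmod (g (k + n)) \<le> cmod (g k) / 16 ^ n"
proof (induction n)
  case (Suc n)
  then show ?case using norm_g_Suc_le[of "k + n"] by simp
qed simp

lemma norm_g_less: "k < l \<Longrightarrow> cmod (g l) \<le> cmod (g k) / 16"
proof -
  assume "k < l"
  then obtain n where l: "l = Suc k + n" by (auto simp: less_iff_Suc_add)
  have "cmod (g l) \<le> cmod (g (Suc k)) / 16 ^ n"
    unfolding l by (rule norm_g_add_le)
  also have "\<dots> \<le> cmod (g (Suc k))"
    by (simp add: divide_le_eq mult_le_cancel_left1)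
  also have "\<dots> \<le> cmod (g k) / 16" by (rule norm_g_Suc_le)
  finally show ?thesis .
qed

lemma norm_g_le: "cmod (g k) \<le> \<gamma> / 16 ^ k"
  using norm_g_add_le[of 0 k] \<gamma> by (simp add: g_0)

lemma norm_x_bounds: "cmod (g k) \<le> cmod (x k)" "cmod (x k) \<le> 2 * cmod (g k)"
proof -
  have "1 \<le> cmod (1 - \<i> * of_real (b k))"
    using abs_Re_le_cmod[of "1 - \<i> * of_real (b k)"] by simp
  then show "cmod (g k) \<le> cmod (x k)"
    by (simp add: x_def norm_mult mult_le_cancel_right1)
  have "cmod (1 - \<i> * of_real (b k)) \<le> 2"
    using norm_triangle_ineq4[of 1 "\<i> * of_real (b k)"] bounds(2)[of k] by (simp add: norm_mult)
  then show "cmod (x k) \<le> 2 * cmod (g k)"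
    by (simp add: x_def norm_mult mult_right_mono)
qed

text \<open>The norm of \<open>x k\<close> lies between one and two times that of
  \<open>g k\<close>, while gradients shrink by a factor 16 per step. So the ball of radius
  \<open>cmod (g k) / 4\<close> around one iterate misses all the others.\<close>

lemma x_separated:
  assumes "k \<noteq> l"
  shows "cmod (g k) / 4 < cmod (x l - x k)"
proof -
  have "0 < cmod (g k)" "0 < cmod (g l)" using bounds(3) by auto
  consider "k < l" | "l < k" using assms by linarith
  then show ?thesis
  proof cases
    case 1
    then show ?thesis
      using norm_g_less[OF 1] norm_x_bounds[of k] norm_x_bounds[of l]
        norm_triangle_ineq2[of "x k" "x l"] \<open>0 < cmod (g k)\<close> unfolding norm_minus_commute[of "x l"] by linarith
  next
    case 2
    then show ?thesis
      using norm_g_less[OF 2] norm_x_bounds[of k] norm_x_bounds[of l]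
        norm_triangle_ineq2[of "x l" "x k"] \<open>0 < cmod (g k)\<close> by linarith
  qed
qed

text \<open>The growing exponent is what makes the bumps decay faster than any power of their
  radius. For odd \<open>k\<close> the parameter is about minus its predecessor \<open>b l\<close>
  and must be small against the later gradient \<open>g k\<close>; the factor
  \<open>\<bar>b (l - 1)\<bar> / 4\<close> in the recursion pays for this, being a lower bound for
  the ratio \<open>cmod (z l)\<close>.\<close>

lemma b_le_norm_g_power:
  assumes "2 \<le> k"
  shows "\<bar>b k\<bar> \<le> cmod (g k) ^ k"
proof -
  have even_case: "\<bar>b k\<bar> \<le> (cmod (g k) * \<bar>b (k - 1)\<bar> / 4) ^ (k + 1)" if "even k" "2 \<le> k" for k
    using that b_Suc[of "k - 1"] even_bounds(1)[of k] by (cases k) auto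
  show ?thesis
  proof (cases "even k")
    case True
    note even_case[OF True assms]
    also have "(cmod (g k) * \<bar>b (k - 1)\<bar> / 4) ^ (k + 1) \<le> cmod (g k) ^ (k + 1)"
      using bounds(2)[of "k - 1"] mult_left_mono[of "\<bar>b (k - 1)\<bar> / 4" 1 "cmod (g k)"]
      by (intro power_mono) auto
    also have "\<dots> \<le> cmod (g k) ^ k"
      using bounds(4)[of k] by (intro power_decreasing) auto
    finally show ?thesis .
  next
    case False
    then obtain l where k: "k = Suc l" and l: "even l" by (cases k) auto
    with assms False have "2 \<le> l" by (cases "l = 1") auto
    have "\<bar>b k\<bar> \<le> \<bar>b l\<bar>"
      using b_Suc_even(1,2)[OF l even_bounds(1,3)[OF l]] even_bounds(1)[OF l] by (simp add: k)
    also note even_case[OF l \<open>2 \<le> l\<close>]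
    also have "(cmod (g l) * \<bar>b (l - 1)\<bar> / 4) ^ (l + 1) \<le> cmod (g k) ^ (l + 1)"
    proof (rule power_mono)
      obtain i where i: "l = Suc i" "odd i" using l \<open>2 \<le> l\<close> by (cases l) auto
      then obtain h where h: "i = Suc h" "even h" by (cases i) auto
      have "b i < 0" "- (1 / 16) \<le> b i"
        using b_Suc_even(1,2)[OF h(2) even_bounds(1,3)[OF h(2)]] even_bounds(1,3)[OF h(2)]
        by (auto simp: h(1))
      from b_Suc_odd(3)[OF i(2) this] bounds(3,4)[of "Suc i"]
      have "\<bar>b (l - 1)\<bar> / 4 \<le> \<bar>p l + b l\<bar> / 2"
        using \<open>b i < 0\<close> by (simp add: i(1))
      also have "\<dots> \<le> cmod (z l)" by (rule norm_z_ge')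
      finally have "\<bar>b (l - 1)\<bar> / 4 * cmod (g l) \<le> cmod (z l) * cmod (g l)"
        by (rule mult_right_mono) simp
      then show "cmod (g l) * \<bar>b (l - 1)\<bar> / 4 \<le> cmod (g k)"
        by (simp add: k norm_g_Suc mult.commute)
    qed simp
    finally show ?thesis by (simp add: k)
  qed
qed

text \<open>The two facts that destroy higher Q-order: cancellation makes the gradient at
  \<open>m + 2\<close> a high power of \<open>b m\<close>, yet the following ratio is only of first
  order in \<open>b m\<close>.\<close>

lemma slow_step:
  assumes "even m"
  shows "cmod (g (m + 2)) \<le> b m ^ (m + 2)" "b m / 8 \<le> cmod (z (m + 2))"
proof -
  note e = even_bounds[OF assms]
  note o = b_Suc_even[OF assms e(1,3)]
  have "cmod (g (m + 2)) \<le> cmod (z (Suc m)) * 1"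
    using bounds(4)[of "Suc m"] by (simp add: norm_g_Suc[of "Suc m"] mult_left_le)
  also have "\<dots> \<le> b m ^ (m + 2)"
    using norm_z_le[of "Suc m"] o(3) zero_less_power[OF e(1), of "m + 2"]
    by (simp del: power_Suc add_2_eq_Suc')
  finally show "cmod (g (m + 2)) \<le> b m ^ (m + 2)" .
  have "b (Suc m) < 0" "- (1 / 16) \<le> b (Suc m)" using o(1,2) e(1,3) by auto
  from b_Suc_odd(3)[OF _ this] bounds(3,4)[of "Suc (Suc m)"] assms
  have "\<bar>b (Suc m)\<bar> / 2 \<le> \<bar>p (Suc (Suc m)) + b (Suc (Suc m))\<bar>"
    using \<open>b (Suc m) < 0\<close> by simp
  moreover have "b m / 2 \<le> \<bar>b (Suc m)\<bar>" using o(2) by simp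
  ultimately have "b m / 4 \<le> \<bar>p (Suc (Suc m)) + b (Suc (Suc m))\<bar>" by simp
  then have "b m / 8 \<le> \<bar>p (m + 2) + b (m + 2)\<bar> / 2" by simp
  also have "\<dots> \<le> cmod (z (m + 2))" by (rule norm_z_ge')
  finally show "b m / 8 \<le> cmod (z (m + 2))" .
qed

section \<open>Verification of the BFGS conditions for the iterates\<close>

lemma g_eq: "g k = (of_real (p k) + \<i>) / of_real (p k + b k) * g (Suc k)"
proof -
  have "z k * ((of_real (p k) + \<i>) / of_real (p k + b k)) = 1"
    using bounds(6)[of k] add_i_neq_0[of "p k"] by (simp add: z_def del: of_real_add)
  then have "g k = z k * ((of_real (p k) + \<i>) / of_real (p k + b k)) * g k"
    by (simp only: mult_1_left)
  also have "\<dots> = (of_real (p k) + \<i>) / of_real (p k + b k) * (z k * g k)"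
    by (simp only: mult_ac)
  finally show ?thesis by (simp only: g_Suc)
qed

text \<open>As multiples of \<open>g (Suc k)\<close>, the claim is that a complex factor has real
  part 0. The real part of (1 - i b)(p + i) is p + b, which the denominator turns into 1; this is
  where the formula for \<open>z\<close> comes from.\<close>

lemma exact_step: "g (Suc k) \<bullet> (x (Suc k) - x k) = 0"
proof -
  let ?s = "p k + b k"
  let ?w = "(1 - \<i> * of_real (b (Suc k))) - (1 - \<i> * of_real (b k)) * (of_real (p k) + \<i>) / of_real ?s"
  have "x (Suc k) - x k = ?w * g (Suc k)"
    unfolding x_def by (subst g_eq[of k]) (simp only: left_diff_distrib times_divide_eq_right times_divide_eq_left mult.assoc)
  then have "g (Suc k) \<bullet> (x (Suc k) - x k) = (1 * g (Suc k)) \<bullet> (?w * g (Suc k))" by simp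
  also have "\<dots> = Re ?w * (cmod (g (Suc k)))\<^sup>2"
    by (subst complex_inner_mult_right_self) (simp only: mult_1_left cnj.simps(1))
  also have "Re ?w = 0"
    using bounds(6)[of k] by (simp add: Re_divide_of_real algebra_simps del: of_real_add)
  finally show ?thesis by simp
qed

text \<open>Because \<open>p (Suc k)\<close> is \<open>b k\<close>, the denominator of
  \<open>z (Suc k)\<close> cancels against the conjugated gradient difference. Both remaining
  products have real part \<open>b k + b (Suc k)\<close>, whatever the value of
  \<open>b (Suc (Suc k))\<close>, so the parameters can be chosen freely.\<close>

lemma conjugate_step: "(x (Suc (Suc k)) - x (Suc k)) \<bullet> (g (Suc k) - g k) = 0"
proof -
  let ?s = "p k + b k" and ?h = "g (Suc k)"
  let ?c = "1 - \<i> * of_real (b (Suc k)) :: complex" and ?c' = "1 - \<i> * of_real (b (Suc (Suc k))) :: complex"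
  have x: "x (Suc (Suc k)) - x (Suc k) = (?c' * z (Suc k) - ?c) * ?h"
    by (simp add: x_def g_Suc[of "Suc k"] algebra_simps)
  have "g (Suc k) - g k = (1 - (of_real (p k) + \<i>) / of_real ?s) * ?h"
    by (subst g_eq[of k]) (simp only: left_diff_distrib mult_1_left)
  also have "1 - (of_real (p k) + \<i>) / of_real ?s = (of_real (b k) - \<i>) / of_real ?s"
  proof -
    have "complex_of_real ?s \<noteq> 0" using bounds(6)[of k] by (simp only: of_real_eq_0_iff not_False_eq_True)
    then have "1 - (of_real (p k) + \<i>) / of_real ?s = (of_real ?s - (of_real (p k) + \<i>)) / of_real ?s"
      by (simp add: diff_divide_distrib del: of_real_add)
    then show ?thesis by simp
  qed
  finally have y: "g (Suc k) - g k = (of_real (b k) - \<i>) / of_real ?s * ?h" .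
  have "(?c' * z (Suc k) - ?c) * cnj ((of_real (b k) - \<i>) / of_real ?s)
      = (?c' * of_real (b k + b (Suc k)) - ?c * (of_real (b k) + \<i>)) / of_real ?s"
  proof -
    have "(?c' * (n / d) - ?c) * (d / s) = (?c' * n - ?c * d) / s" if "d \<noteq> 0" for n d s :: complex
      using that by (simp add: left_diff_distrib diff_divide_distrib)
    moreover have "cnj ((of_real (b k) - \<i>) / of_real ?s) = (of_real (b k) + \<i>) / of_real ?s"
      by simp
    ultimately show ?thesis
      by (simp only: z_def p_Suc add_i_neq_0 not_False_eq_True)
  qed
  also have "Re \<dots> = 0"
    by (simp add: Re_divide_of_real del: of_real_add)
  finally show ?thesis
    unfolding x y complex_inner_mult_right_self by (simp only: mult_zero_left)
qed

text \<open>The step is \<open>- g k\<close> up to a small perturbation: its factor has real part at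
  most 2 / 16 - 1.\<close>

lemma descent_step: "g k \<bullet> (x (Suc k) - x k) < 0"
proof -
  let ?c = "1 - \<i> * of_real (b k) :: complex" and ?c' = "1 - \<i> * of_real (b (Suc k)) :: complex"
  have "x (Suc k) - x k = (?c' * z k - ?c) * g k"
    by (simp add: x_def g_Suc algebra_simps)
  then have eq: "g k \<bullet> (x (Suc k) - x k) = Re (?c' * z k - ?c) * (cmod (g k))\<^sup>2"
    using complex_inner_mult_right_self[of 1 "g k" "?c' * z k - ?c"] by simp
  have "Re (?c' * z k - ?c) \<le> cmod (?c' * z k) - 1"
    using complex_Re_le_cmod[of "?c' * z k"] by simp
  also have "\<dots> \<le> 2 * (1 / 16) - 1"
  proof -
    have "cmod ?c' \<le> 2"
      using norm_triangle_ineq4[of 1 "\<i> * of_real (b (Suc k))"] bounds(2)[of "Suc k"]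
      by (simp add: norm_mult)
    then show ?thesis
      using mult_mono[OF _ norm_z_le_16[of k], of "cmod ?c'" 2] by (simp add: norm_mult)
  qed
  finally have "Re (?c' * z k - ?c) < 0" by simp
  moreover have "0 < (cmod (g k))\<^sup>2" using bounds(3)[of k] by simp
  ultimately show ?thesis unfolding eq by (rule mult_neg_pos)
qed

text \<open>The initial value \<open>p 0 = 0\<close> makes \<open>z 0\<close> purely imaginary, and
  the imaginary parts cancel. So the first step follows the negative gradient, as the identity
  matrix demands.\<close>

lemma steepest_step: "x 1 - x 0 = - (of_real (1 + b 0 * b 1) * g 0)"
proof -
  have "z 0 = - \<i> * of_real (b 0)"
    by (simp add: z_def p_0 field_simps)
  then show ?thesis
    by (simp add: x_def g_Suc[of 0, simplified] algebra_simps)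
qed

lemma steepest_pos: "0 < 1 + b 0 * b 1"
proof -
  have "\<bar>b 0 * b 1\<bar> \<le> 1 / 16 * (1 / 16)"
    unfolding abs_mult using bounds(2) by (intro mult_mono) auto
  then show ?thesis by linarith
qed

end

section \<open>The objective function\<close>

text \<open>The second bound on \<open>M\<close> keeps the perturbation
  \<open>32 * \<delta> * M\<close> of the Hessian at or below one half, which secures strong
  convexity.\<close>

locale objective = iterate_parameters \<delta> \<gamma> for \<delta> \<gamma> +
  fixes i j :: "'n::finite" and M :: real
  assumes ij: "i \<noteq> j"
    and M: "0 < M" "64 * \<delta> * M \<le> 1"
      "\<And>y u v k. k \<in> {i, j} \<Longrightarrow> \<bar>frechet_derivative (\<lambda>y. frechet_derivative
        (linear_bump (axis k 1 :: real^'n)) (at y) v) (at y) u\<bar> \<le> M * norm u * norm v"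
begin

definition emb :: "complex \<Rightarrow> real^'n" where
  "emb w = Re w *\<^sub>R axis i 1 + Im w *\<^sub>R axis j 1"

lemma inner_emb: "emb u \<bullet> emb v = u \<bullet> v"
  using ij by (simp add: emb_def inner_add_left inner_add_right inner_axis_axis inner_complex_def)

lemma norm_emb: "norm (emb u) = cmod u"
  by (simp add: norm_eq_sqrt_inner inner_emb)

lemma emb_diff: "emb u - emb v = emb (u - v)"
  by (simp add: emb_def algebra_simps)

lemma emb_minus: "emb (- u) = - emb u"
  by (simp add: emb_def)

lemma emb_add: "emb u + emb v = emb (u + v)"
  by (simp add: emb_def algebra_simps)

lemma emb_scale: "c *\<^sub>R emb u = emb (of_real c * u)"
  by (simp add: emb_def algebra_simps)

lemma emb_0: "emb 0 = 0"
  by (simp add: emb_def)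

lemma subspace_emb: "subspace (range emb)"
  by (auto simp: subspace_def emb_add emb_scale simp flip: emb_0)

section \<open>The perturbation and its derivatives\<close>

definition X where "X k = emb (x k)"
definition r where "r k = cmod (g k) / 4"
definition e where "e k = g k - x k"
text \<open>Rescaling a bump to radius \<open>r k\<close> divides its gradient by
  \<open>r k\<close>; the factor \<open>r k\<close> in the coefficient restores the prescribed value
  at the centre. As a series has a single profile, each coordinate of \<open>e k\<close> gets its
  own series.\<close>

definition S1 where "S1 = bump_series (\<lambda>k. r k * Re (e k)) r X (linear_bump (axis i 1))"
definition S2 where "S2 = bump_series (\<lambda>k. r k * Im (e k)) r X (linear_bump (axis j 1))"
definition S where "S v = S1 v + S2 v"
definition F where "F v = std_quad v + S v"

lemma r_pos: "0 < r k"
  using bounds(3)[of k] by (simp add: r_def)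

lemma norm_g_le_geometric: "cmod (g k) \<le> (1 / 16) ^ k"
proof -
  have "\<gamma> / 16 ^ k \<le> (1 / 16) ^ k"
    using \<gamma> by (simp add: power_one_over divide_right_mono)
  with norm_g_le[of k] show ?thesis by linarith
qed

lemma norm_e: "cmod (e k) = \<bar>b k\<bar> * cmod (g k)"
  by (simp add: e_def x_def algebra_simps norm_mult)

text \<open>Both the gradient perturbation and the radius are proportional to
  \<open>cmod (g k)\<close>. Their quotient, which controls the Hessian, is therefore at most 4
  times \<open>\<bar>b k\<bar>\<close>, regardless of scale.\<close>

lemma coefficient_bound:
  assumes "\<bar>t\<bar> \<le> cmod (e k)"
  shows "\<bar>r k * t\<bar> \<le> \<bar>b k\<bar>" "\<bar>r k * t / r k / r k\<bar> \<le> 8 * \<delta> / 2 ^ k"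
proof -
  have "\<bar>r k * t\<bar> \<le> r k * (\<bar>b k\<bar> * cmod (g k))"
    using assms r_pos[of k] by (simp add: abs_mult norm_e)
  also have "\<dots> \<le> 1 * (\<bar>b k\<bar> * 1)"
    using bounds(4)[of k] by (intro mult_mono) (auto simp: r_def)
  finally show "\<bar>r k * t\<bar> \<le> \<bar>b k\<bar>" by simp
  have "\<bar>r k * t / r k / r k\<bar> = \<bar>t\<bar> / r k"
    using r_pos[of k] by simp
  also have "\<dots> \<le> \<bar>b k\<bar> * cmod (g k) / r k"
    using assms r_pos[of k] by (intro divide_right_mono) (simp_all add: norm_e)
  also have "\<dots> = 4 * \<bar>b k\<bar>"
    using bounds(3)[of k] by (simp add: r_def)
  finally show "\<bar>r k * t / r k / r k\<bar> \<le> 8 * \<delta> / 2 ^ k"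
    using bounds(1)[of k] by simp
qed

text \<open>The coefficient is at most \<open>cmod (g k) ^ (m + 1)\<close> for large
  \<open>k\<close>, so after division by the m-th power of the radius one power of
  \<open>cmod (g k)\<close> survives, and this decays geometrically.\<close>

lemma summable_coefficients:
  assumes "\<And>k. \<bar>t k\<bar> \<le> cmod (e k)"
  shows "summable (\<lambda>k. \<bar>r k * t k\<bar> / r k ^ m)"
proof (rule summable_comparison_test')
  show "summable (\<lambda>k. 4 ^ m * (1 / 16 :: real) ^ k)"
    by (intro summable_mult summable_geometric) simp
  \<comment> \<open>This covers both the range of \<open>b_le_norm_g_power\<close> and the
    comparison of the exponents \<open>k\<close> and \<open>m + 1\<close>.\<close>
  fix k assume k: "m + 2 \<le> k"
  have g: "0 < cmod (g k)" using bounds(3) by simp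
  have "\<bar>r k * t k\<bar> \<le> cmod (g k) ^ k"
    using coefficient_bound(1)[OF assms, of k] b_le_norm_g_power[of k] k by linarith
  also have "\<dots> \<le> cmod (g k) ^ (m + 1)"
    using bounds(4)[of k] k by (intro power_decreasing) auto
  finally have "\<bar>r k * t k\<bar> / r k ^ m \<le> cmod (g k) ^ (m + 1) / r k ^ m"
    using r_pos[of k] by (intro divide_right_mono) auto
  also have "\<dots> = 4 ^ m * cmod (g k)"
    using g by (simp add: r_def power_divide)
  also have "\<dots> \<le> 4 ^ m * (1 / 16) ^ k"
    by (intro mult_left_mono norm_g_le_geometric) simp
  finally show "norm (\<bar>r k * t k\<bar> / r k ^ m) \<le> 4 ^ m * (1 / 16) ^ k"
    using r_pos[of k] by simp
qed

lemma summable_Re: "summable (\<lambda>k. \<bar>r k * Re (e k)\<bar> / r k ^ m)"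
  and summable_Im: "summable (\<lambda>k. \<bar>r k * Im (e k)\<bar> / r k ^ m)"
  by (intro summable_coefficients abs_Re_le_cmod abs_Im_le_cmod)+

lemma smooth_S1: "smooth S1" and smooth_S2: "smooth S2"
  unfolding S1_def S2_def
  by (intro smooth_bump_series r_pos summable_Re summable_Im test_fun_linear_bump)+

lemma smooth_S: "smooth S"
  unfolding S_def[abs_def] by (rule smooth_add[OF smooth_S1 smooth_S2])

lemma smooth_F: "smooth F"
  unfolding F_def[abs_def] by (rule smooth_add[OF smooth_std_quad smooth_S])

lemma S_derivative:
  "frechet_derivative S (at y) v = frechet_derivative S1 (at y) v + frechet_derivative S2 (at y) v"
  unfolding S_def[abs_def] by (rule frechet_derivative_add[OF smooth_S1 smooth_S2])

lemma S_second_derivative: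
  "frechet_derivative (\<lambda>y. frechet_derivative S (at y) v) (at y) u
    = frechet_derivative (\<lambda>y. frechet_derivative S1 (at y) v) (at y) u
    + frechet_derivative (\<lambda>y. frechet_derivative S2 (at y) v) (at y) u"
  unfolding S_derivative
  by (rule frechet_derivative_add[OF smooth_frechet_derivative[OF smooth_S1]
        smooth_frechet_derivative[OF smooth_S2]])

lemma bump_second_derivative_bound:
  assumes "k \<in> {i, j}" "\<And>k. \<bar>t k\<bar> \<le> cmod (e k)"
  shows "\<bar>bump_series (\<lambda>k. r k * t k / r k / r k) r X (\<lambda>y. frechet_derivative (\<lambda>y. frechet_derivative
        (linear_bump (axis k 1)) (at y) v) (at y) u) y\<bar> \<le> 16 * \<delta> * (M * norm u * norm v)"
proof -
  have geo: "summable (\<lambda>k. 8 * \<delta> * (1 / 2) ^ k)"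
    by (intro summable_mult summable_geometric) simp
  have le: "\<bar>r k * t k / r k / r k\<bar> \<le> 8 * \<delta> * (1 / 2) ^ k" for k
    using coefficient_bound(2)[OF assms(2), of k] by (simp add: power_one_over)
  have sm: "summable (\<lambda>k. \<bar>r k * t k / r k / r k\<bar>)"
    by (rule summable_comparison_test'[OF geo]) (use le in simp)
  have "\<bar>bump_series (\<lambda>k. r k * t k / r k / r k) r X (\<lambda>y. frechet_derivative (\<lambda>y. frechet_derivative
        (linear_bump (axis k 1)) (at y) v) (at y) u) y\<bar>
      \<le> (\<Sum>k. \<bar>r k * t k / r k / r k\<bar>) * (M * norm u * norm v)"
    by (rule bump_series_bound[OF sm M(3)[OF assms(1)]])
  also have "\<dots> \<le> (\<Sum>k. 8 * \<delta> * (1 / 2) ^ k) * (M * norm u * norm v)"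
    using M(1) by (intro mult_right_mono suminf_le le sm geo) auto
  also have "(\<Sum>k. 8 * \<delta> * (1 / 2) ^ k) = 16 * \<delta>"
    by (subst suminf_mult) (auto simp: suminf_geometric)
  finally show ?thesis .
qed

lemma S_second_derivative_bound:
  "\<bar>frechet_derivative (\<lambda>y. frechet_derivative S (at y) v) (at y) u\<bar> \<le> 32 * \<delta> * M * norm u * norm v"
proof -
  have "\<bar>frechet_derivative (\<lambda>y. frechet_derivative S1 (at y) v) (at y) u\<bar> \<le> 16 * \<delta> * (M * norm u * norm v)"
    unfolding S1_def second_derivative_bump_series[OF r_pos summable_Re test_fun_linear_bump]
    by (intro bump_second_derivative_bound abs_Re_le_cmod) simp
  moreover have "\<bar>frechet_derivative (\<lambda>y. frechet_derivative S2 (at y) v) (at y) u\<bar> \<le> 16 * \<delta> * (M * norm u * norm v)"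
    unfolding S2_def second_derivative_bump_series[OF r_pos summable_Im test_fun_linear_bump]
    by (intro bump_second_derivative_bound abs_Im_le_cmod) simp
  ultimately show ?thesis unfolding S_second_derivative by (simp add: algebra_simps)
qed

lemma strongly_convex_F: "strongly_convex F"
  unfolding F_def[abs_def]
proof (rule strongly_convex_std_quad_add[OF smooth_S])
  show "0 \<le> 32 * \<delta> * M" "32 * \<delta> * M < 1" using \<delta> M(1,2) by auto
  show "\<bar>frechet_derivative (\<lambda>y. frechet_derivative S (at y) v) (at y) v\<bar> \<le> 32 * \<delta> * M * (norm v)\<^sup>2" for y v
    using S_second_derivative_bound[of v y v] by (simp add: power2_eq_square mult.assoc)
qed

lemma hessian_F: "hessian F y = mat 1 + hessian S y"
  unfolding F_def[abs_def] by (rule hessian_std_quad_add[OF smooth_S])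

lemma op_norm_hessian: "op_norm (hessian F y - mat 1) \<le> real CARD('n) * real CARD('n) * (32 * \<delta> * M)"
proof (rule onorm_le_matrix_component)
  show "\<bar>(hessian F y - mat 1) $ k $ l\<bar> \<le> 32 * \<delta> * M" for k l
    using S_second_derivative_bound[of "axis k 1" y "axis l 1"]
    by (simp add: hessian_F hessian_nth[OF smooth_S] norm_axis_1)
qed

lemma bumps_far:
  assumes "\<And>k. r k < norm (y - X k)"
  shows "S y = 0" "frechet_derivative S (at y) v = 0"
    "frechet_derivative (\<lambda>y. frechet_derivative S (at y) v) (at y) u = 0"
proof -
  note z = bump_series_eq_0[OF _ r_pos assms]
  note t = test_fun_linear_bump
  show "S y = 0"
    by (simp add: S_def S1_def S2_def z t)
  show "frechet_derivative S (at y) v = 0"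
    unfolding S_derivative S1_def S2_def frechet_derivative_bump_series[OF r_pos summable_Re t]
      frechet_derivative_bump_series[OF r_pos summable_Im t]
    by (simp add: z test_fun_derivative t)
  show "frechet_derivative (\<lambda>y. frechet_derivative S (at y) v) (at y) u = 0"
    unfolding S_second_derivative S1_def S2_def
      second_derivative_bump_series[OF r_pos summable_Re t]
      second_derivative_bump_series[OF r_pos summable_Im t]
    by (simp add: z test_fun_derivative t)
qed

text \<open>The balls accumulate at the origin but none contains it, so every term of the
  perturbation and of its differentiated series vanishes there.\<close>

lemma origin_far: "r k < norm (0 - X k)"
proof -
  have "0 < cmod (g k)" using bounds(3) by simp
  then show ?thesis
    using norm_x_bounds(1)[of k] unfolding r_def X_def norm_minus_cancel diff_0 norm_emb by linarith
qed

lemma F_has_derivative: "(F has_derivative (\<lambda>v. y \<bullet> v + frechet_derivative S (at y) v)) (at y)"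
proof -
  have "F = (\<lambda>v. std_quad v + S v)" by (rule ext) (rule F_def)
  with has_derivative_add[OF std_quad_has_derivative[of y] smooth_has_derivative[OF smooth_S, of y]]
  show ?thesis by (simp only:)
qed

lemma grad_F_eq: "grad F y \<bullet> v = y \<bullet> v + frechet_derivative S (at y) v"
proof -
  have "grad F y \<bullet> v = frechet_derivative F (at y) v"
    by (rule frechet_derivative_eq_grad[OF smooth_F, symmetric])
  also have "\<dots> = y \<bullet> v + frechet_derivative S (at y) v"
    by (rule fun_cong[OF frechet_derivative_at[OF F_has_derivative, symmetric]])
  finally show ?thesis .
qed

lemma grad_F_X: "grad F (X l) = emb (g l)"
proof -
  note t = test_fun_linear_bump
  \<comment> \<open>At \<open>X l\<close> only the bump with index \<open>l\<close> is active, and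
    it contributes exactly \<open>e l\<close> to the gradient.\<close>
  have far: "r k < norm (X l - X k)" if "k \<noteq> l" for k
    using x_separated[OF that] by (simp add: r_def X_def emb_diff norm_emb)
  note single = bump_series_single[OF test_fun_derivative[OF t] r_pos far]
  have "grad F (X l) \<bullet> v = emb (g l) \<bullet> v" for v
  proof -
    have "grad F (X l) \<bullet> v = X l \<bullet> v + (Re (e l) * (axis i 1 \<bullet> v) + Im (e l) * (axis j 1 \<bullet> v))"
      unfolding grad_F_eq S_derivative S1_def S2_def
        frechet_derivative_bump_series[OF r_pos summable_Re t]
        frechet_derivative_bump_series[OF r_pos summable_Im t]
      using r_pos[of l] by (simp add: single linear_bump_derivative_0)
    also have "\<dots> = (X l + emb (e l)) \<bullet> v"
      by (simp add: emb_def inner_add_left)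
    also have "X l + emb (e l) = emb (g l)"
      by (simp add: X_def emb_add e_def)
    finally show ?thesis .
  qed
  then show ?thesis by (rule vector_eq_rdot[THEN iffD1, OF allI])
qed

lemma X_conv_0: "X \<longlonglongrightarrow> 0"
proof (rule Lim_null_comparison)
  show "\<forall>\<^sub>F k in sequentially. norm (X k) \<le> 2 * (1 / 16) ^ k"
  proof (rule always_eventually, rule allI)
    fix k
    show "norm (X k) \<le> 2 * (1 / 16) ^ k"
      using norm_x_bounds(2)[of k] norm_g_le_geometric[of k] by (simp add: X_def norm_emb)
  qed
  show "(\<lambda>k. 2 * (1 / 16 :: real) ^ k) \<longlonglongrightarrow> 0"
    by (intro tendsto_mult_right_zero LIMSEQ_realpow_zero) auto
qed

lemma norm_X: "norm (X k) = cmod (x k)"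
  by (simp add: X_def norm_emb)

lemma norm_X_pos: "0 < norm (X k)"
  using norm_x_bounds(1)[of k] bounds(3)[of k] by (auto simp: norm_X)

sublocale planar_bfgs F X "range emb"
proof
  show "smooth F" "strongly_convex F" "subspace (range emb)"
    by (rule smooth_F strongly_convex_F subspace_emb)+
  show "\<exists>c. u = c *\<^sub>R v" if uvw: "u \<in> range emb" "v \<in> range emb" "w \<in> range emb" "v \<noteq> 0" "w \<noteq> 0"
    "u \<bullet> w = 0" "v \<bullet> w = 0" for u v w
  proof -
    obtain u' v' w' where eq: "u = emb u'" "v = emb v'" "w = emb w'" using uvw(1-3) by blast
    have "v' \<noteq> 0" "w' \<noteq> 0" using uvw(4,5) emb_0 unfolding eq by metis+
    with uvw(6,7) obtain c where "u' = of_real c * v'"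
      unfolding eq inner_emb using complex_orthogonal_parallel by blast
    then have "u = c *\<^sub>R v" unfolding eq emb_scale by (rule arg_cong)
    then show ?thesis ..
  qed
  show "X k \<in> range emb" "grad F (X k) \<in> range emb" for k
    by (simp_all only: grad_F_X) (simp_all only: X_def rangeI)
  show "grad F (X (Suc k)) \<bullet> (X (Suc k) - X k) = 0" for k
    unfolding grad_F_X unfolding X_def emb_diff inner_emb by (rule exact_step)
  show "(X (Suc (Suc k)) - X (Suc k)) \<bullet> (grad F (X (Suc k)) - grad F (X k)) = 0" for k
    unfolding grad_F_X unfolding X_def emb_diff inner_emb by (rule conjugate_step)
  show "grad F (X k) \<bullet> (X (Suc k) - X k) < 0" for k
    unfolding grad_F_X unfolding X_def emb_diff inner_emb by (rule descent_step)
  show "\<exists>\<mu>>0. X 1 - X 0 = - (\<mu> *\<^sub>R grad F (X 0))"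
  proof (intro exI conjI)
    show "0 < 1 + b 0 * b 1" by (rule steepest_pos)
    show "X 1 - X 0 = - ((1 + b 0 * b 1) *\<^sub>R grad F (X 0))"
      unfolding grad_F_X unfolding X_def emb_diff steepest_step emb_scale by (rule emb_minus)
  qed
qed

text \<open>Centres have norm at most 2 \<gamma> and radii are at most \<gamma> / 4.\<close>

lemma supp_S: "supp S \<subseteq> cball 0 (3 * \<gamma>)" "compact (supp S)"
proof -
  have "S y = 0" if "3 * \<gamma> < norm y" for y
  proof (rule bumps_far(1))
    fix k
    have "\<gamma> / 16 ^ k \<le> \<gamma>" using \<gamma> by (simp add: divide_le_eq mult_le_cancel_left1)
    then have "cmod (g k) \<le> \<gamma>" using norm_g_le[of k] by linarith
    then show "r k < norm (y - X k)"
      using norm_x_bounds(2)[of k] norm_triangle_ineq2[of y "X k"] that \<gamma>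
      unfolding r_def norm_X by linarith
  qed
  then have "support_on UNIV S \<subseteq> cball 0 (3 * \<gamma>)"
    unfolding support_on_def by (intro subsetI) (simp, metis not_less)
  then show *: "supp S \<subseteq> cball 0 (3 * \<gamma>)"
    unfolding supp_def by (rule closure_minimal) simp
  have "bounded (supp S)" by (rule bounded_subset[OF bounded_cball *])
  moreover have "closed (supp S)" by (simp add: supp_def)
  ultimately show "compact (supp S)" by (simp add: compact_eq_bounded_closed)
qed

lemma grad_F_0: "grad F 0 = 0"
proof -
  have "grad F 0 \<bullet> v = 0 \<bullet> v" for v
    using bumps_far(2)[OF origin_far, of v] by (simp add: grad_F_eq)
  then show ?thesis by (rule vector_eq_rdot[THEN iffD1, OF allI])
qed

lemma hessian_F_0: "hessian F 0 = mat 1"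
  by (simp add: hessian_F vec_eq_iff hessian_nth[OF smooth_S] bumps_far(3)[OF origin_far])

lemma minimizer_F_iff: "minimizer F y \<longleftrightarrow> y = 0"
proof -
  obtain m where m: "m > 0" and first_order: "\<And>u v f'. (F has_derivative f') (at u) \<Longrightarrow>
      F u + f' (v - u) + m / 2 * (norm (v - u))\<^sup>2 \<le> F v"
    using strongly_convex_obtain[OF strongly_convex_F] by blast
  have growth: "F 0 + m / 2 * (norm v)\<^sup>2 \<le> F v" for v
    using first_order[OF smooth_has_derivative[OF smooth_F], of 0 v]
    by (simp add: frechet_derivative_eq_grad[OF smooth_F] grad_F_0)
  have "F 0 < F v" if "v \<noteq> 0" for v
  proof -
    have "0 < m / 2 * (norm v)\<^sup>2" using m that by simp
    with growth[of v] show ?thesis by linarith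
  qed
  then have "y = 0" if "minimizer F y"
    using that unfolding minimizer_def is_arg_min_def by blast
  moreover have "minimizer F 0"
  proof -
    have "F 0 \<le> F v" for v
      using growth[of v] m zero_le_power2[of "norm v"] by (smt (verit) mult_nonneg_nonneg half_gt_zero)
    then show ?thesis by (simp add: minimizer_def is_arg_min_def not_less)
  qed
  ultimately show ?thesis by blast
qed

section \<open>Superlinear convergence and Q-order exactly one\<close>

lemma p_b_bound: "\<bar>p k + b k\<bar> \<le> 6 * \<delta> * (1 / 2) ^ k"
proof (cases k)
  case 0
  then show ?thesis using \<delta> by (simp add: p_0 b_0)
next
  case (Suc l)
  have "\<bar>p k + b k\<bar> \<le> \<bar>b l\<bar> + \<bar>b k\<bar>" by (simp add: Suc p_Suc)
  also have "\<dots> \<le> 2 * \<delta> / 2 ^ l + 2 * \<delta> / 2 ^ k" by (intro add_mono bounds(1))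
  \<comment> \<open>Rewriting the bound for index \<open>l\<close> in terms of
    \<open>k = l + 1\<close> doubles it, so 6 arises as 4 + 2.\<close>
  also have "\<dots> = 6 * \<delta> * (1 / 2) ^ k" by (simp add: Suc power_one_over)
  finally show ?thesis .
qed

lemma q_superlinear_X: "q_superlinear X 0"
  unfolding q_superlinear_def
proof (rule Lim_null_comparison)
  show "\<forall>\<^sub>F k in sequentially. norm (norm (X (Suc k) - 0) / norm (X k - 0)) \<le> 12 * \<delta> * (1 / 2) ^ k"
  proof (rule always_eventually, rule allI)
    fix k
    have "norm (X (Suc k)) \<le> 2 * (cmod (z k) * cmod (g k))"
      using norm_x_bounds(2)[of "Suc k"] by (simp add: norm_X norm_g_Suc)
    also have "\<dots> \<le> 2 * (6 * \<delta> * (1 / 2) ^ k * norm (X k))"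
      using order_trans[OF norm_z_le p_b_bound, of k] norm_x_bounds(1)[of k] \<delta>
      by (intro mult_left_mono mult_mono) (auto simp: norm_X)
    finally show "norm (norm (X (Suc k) - 0) / norm (X k - 0)) \<le> 12 * \<delta> * (1 / 2) ^ k"
      using norm_X_pos[of k] by (simp add: divide_le_eq)
  qed
  show "(\<lambda>k. 12 * \<delta> * (1 / 2) ^ k) \<longlonglongrightarrow> 0"
    by (intro tendsto_mult_right_zero LIMSEQ_realpow_zero) auto
qed

text \<open>An exponent q > 1 would bound the ratio at \<open>m + 2\<close> by a constant times
  \<open>G powr (q - 1)\<close>, hence by a multiple of \<beta>^2 once \<open>m\<close> is large. By
  \<open>slow_step\<close> that ratio is at least \<beta> / 8, which is impossible as \<beta> tends
  to 0.\<close>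

lemma q_order_le_1:
  assumes "q_order_at_least X 0 q"
  shows "q \<le> 1"
proof (rule ccontr)
  assume "\<not> q \<le> 1"
  then have q: "1 < q" by simp
  from assms obtain C k0 where C: "C > 0"
    and step: "\<And>k. k \<ge> k0 \<Longrightarrow> norm (X (Suc k)) \<le> C * norm (X k) powr q"
    unfolding q_order_at_least_def by auto
  define D where "D = 8 * C * 2 powr q"
  have "(\<lambda>m. D * (2 * \<delta>) * (1 / 2) ^ m) \<longlonglongrightarrow> 0"
    by (intro tendsto_mult_right_zero LIMSEQ_realpow_zero) auto
  then have "\<forall>\<^sub>F m in sequentially. D * (2 * \<delta>) * (1 / 2) ^ m < 1"
    by (rule order_tendstoD) simp
  then obtain m0 where m0: "\<And>m. m \<ge> m0 \<Longrightarrow> D * (2 * \<delta>) * (1 / 2) ^ m < 1"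
    by (auto simp: eventually_sequentially)
  obtain n1 where n1: "2 / (q - 1) \<le> real n1" using real_arch_simple by blast
  \<comment> \<open>Evenness selects a slow step; \<open>n1\<close> makes the exponent
    \<open>(m + 2) * (q - 1)\<close> at least 2, and \<open>m0\<close> serves the final
    contradiction.\<close>
  define m where "m = 2 * (m0 + k0 + n1)"
  have m: "even m" "m \<ge> m0" "m + 2 \<ge> k0" "n1 \<le> m + 2" by (auto simp: m_def)
  define \<beta> where "\<beta> = b m"
  have \<beta>: "0 < \<beta>" "\<beta> \<le> 1" using even_bounds(1,3)[OF m(1)] by (auto simp: \<beta>_def)
  define G where "G = cmod (g (m + 2))"
  have G: "0 < G" "G \<le> \<beta> ^ (m + 2)"
    using bounds(3) slow_step(1)[OF m(1)] by (auto simp: G_def \<beta>_def)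
  have "2 \<le> real n1 * (q - 1)" using n1 q by (simp add: pos_divide_le_eq)
  also have "\<dots> \<le> real (m + 2) * (q - 1)" using m(4) q by (intro mult_right_mono) auto
  finally have exponent: "2 \<le> real (m + 2) * (q - 1)" .
  have "cmod (z (m + 2)) * G \<le> norm (X (Suc (m + 2)))"
    using norm_x_bounds(1)[of "Suc (m + 2)"] by (simp only: norm_X norm_g_Suc G_def)
  also have "\<dots> \<le> C * norm (X (m + 2)) powr q" by (rule step[OF m(3)])
  also have "\<dots> \<le> C * (2 * G) powr q"
    using C q norm_x_bounds(2)[of "m + 2"]
    by (intro mult_left_mono powr_mono2) (auto simp: norm_X G_def)
  also have "\<dots> = C * 2 powr q * G powr (q - 1) * G"
    using G(1) powr_add[of G "q - 1" 1] by (simp add: powr_mult)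
  finally have "cmod (z (m + 2)) \<le> C * 2 powr q * G powr (q - 1)"
    using G(1) by simp
  also have "G powr (q - 1) \<le> (\<beta> powr real (m + 2)) powr (q - 1)"
    using G(1) q by (intro powr_mono2 G(2)[folded powr_realpow[OF \<beta>(1)]]) auto
  also have "\<dots> \<le> \<beta> powr 2"
    unfolding powr_powr using exponent \<beta> by (intro powr_mono') auto
  also have "\<dots> = \<beta> * \<beta>" using \<beta>(1) by (simp add: power2_eq_square powr_numeral)
  finally have "cmod (z (m + 2)) \<le> C * 2 powr q * (\<beta> * \<beta>)"
    using C by simp
  then have "\<beta> / 8 \<le> C * 2 powr q * (\<beta> * \<beta>)"
    using slow_step(2)[OF m(1)] by (simp add: \<beta>_def)
  then have "1 \<le> D * \<beta>" using \<beta>(1) by (simp add: D_def)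
  also have "\<dots> \<le> D * (2 * \<delta>) * (1 / 2) ^ m"
    using mult_left_mono[of \<beta> "2 * \<delta> / 2 ^ m" D] bounds(1)[of m] C
    by (simp add: \<beta>_def D_def power_one_over)
  also have "\<dots> < 1" by (rule m0[OF m(2)])
  finally show False by simp
qed

lemma bfgs_sequence_X: "bfgs_sequence_to F X 0"
  unfolding bfgs_sequence_to_def
proof (intro conjI exI)
  show "smooth F" "strongly_convex F" by (rule smooth_F strongly_convex_F)+
  show "minimizer F 0" by (simp add: minimizer_F_iff)
  show "pos_def (hessian F 0)"
    using sym_pos_def_mat_1 by (simp add: hessian_F_0 sym_pos_def_def)
  show "bfgs_run F (X 0) (mat 1) X H" by (simp add: run_iff)
  have "grad F (X k) \<noteq> 0" for k using descent[of k] by auto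
  then show "nonterminating F X" by (simp add: nonterminating_def)
qed (rule X_conv_0)

lemma q_order_X: "q_order X 0 = 1"
proof (rule antisym)
  show "q_order X 0 \<le> 1"
    unfolding q_order_def using q_order_le_1 by (intro SUP_least) (simp add: one_ereal_def)
qed (rule has_q_order_of_bfgs_sequence[OF bfgs_sequence_X])

end

section \<open>Choice of the parameters and conclusion\<close>

lemma ex_objective:
  fixes \<epsilon> R :: real
  assumes "2 \<le> CARD('n::finite)" "0 < \<epsilon>" "0 < R"
  obtains \<delta> \<gamma> M and i j :: "'n::finite" where "objective \<delta> \<gamma> i j M" "8 * \<gamma> \<le> R"
    "real CARD('n) * real CARD('n) * (32 * \<delta> * M) < \<epsilon>"
proof -
  have "\<exists>i j :: 'n. i \<noteq> j"
  proof (rule ccontr)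
    assume "\<not> ?thesis"
    then have "UNIV \<subseteq> {undefined :: 'n}" by auto
    then have "CARD('n) \<le> 1" using card_mono[of "{undefined :: 'n}" UNIV] by simp
    with assms(1) show False by simp
  qed
  then obtain i j :: 'n where ij: "i \<noteq> j" by blast
  have "\<exists>M>0. \<forall>y u v. \<bar>frechet_derivative (\<lambda>y. frechet_derivative
      (linear_bump (axis k 1 :: real^'n)) (at y) v) (at y) u\<bar> \<le> M * norm u * norm v" for k
    by (rule test_fun_second_derivative_bounded[OF test_fun_linear_bump[of "axis k 1"]]) blast
  then obtain K where K: "\<And>k. K k > 0" "\<And>k y u v. \<bar>frechet_derivative (\<lambda>y. frechet_derivative
      (linear_bump (axis k 1 :: real^'n)) (at y) v) (at y) u\<bar> \<le> K k * norm u * norm v"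
    by metis
  define M where "M = K i + K j"
  have M: "M > 0" using K(1) by (simp add: M_def add_pos_pos)
  define N where "N = real CARD('n) * real CARD('n)"
  have N: "N > 0" using assms(1) by (simp add: N_def)
  \<comment> \<open>The last two bounds give, in turn, strong convexity and a Hessian deviation of
    at most \<epsilon> / 2, so that the inequality for the supremum is strict.\<close>
  define \<delta> where "\<delta> = min (1 / 16) (min (1 / (64 * M)) (\<epsilon> / (64 * N * M)))"
  \<comment> \<open>Radius \<open>R\<close> must exceed both 3 \<gamma>, for the support, and 2
    \<gamma>, for the starting point.\<close>
  define \<gamma> where "\<gamma> = min 1 (R / 8)"
  have \<delta>: "0 < \<delta>" "\<delta> \<le> 1 / 16" "\<delta> \<le> 1 / (64 * M)" "\<delta> \<le> \<epsilon> / (64 * N * M)"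
    using M N assms(2) by (simp_all add: \<delta>_def)
  show ?thesis
  proof
    show "objective \<delta> \<gamma> i j M"
    proof
      show "0 < \<delta>" "\<delta> \<le> 1 / 16" by fact+
      show "0 < \<gamma>" "\<gamma> \<le> 1" using assms(3) by (simp_all add: \<gamma>_def)
      show "i \<noteq> j" "0 < M" by fact+
      show "64 * \<delta> * M \<le> 1" using \<delta>(3) M by (simp add: pos_le_divide_eq mult.assoc mult.left_commute)
      fix y u v :: "real^'n" and k assume "k \<in> {i, j}"
      then have "K k \<le> M" using K(1)[of i] K(1)[of j] by (auto simp: M_def)
      then have "K k * norm u * norm v \<le> M * norm u * norm v"
        by (intro mult_right_mono) auto
      with K(2)[of k v y u] show "\<bar>frechet_derivative (\<lambda>y. frechet_derivative
        (linear_bump (axis k 1)) (at y) v) (at y) u\<bar> \<le> M * norm u * norm v" by linarith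
    qed
    show "8 * \<gamma> \<le> R" by (simp add: \<gamma>_def)
    have "\<delta> * (64 * N * M) \<le> \<epsilon>"
      using \<delta>(4) M N by (simp add: pos_le_divide_eq)
    then have "N * (32 * \<delta> * M) \<le> \<epsilon> / 2" by (simp add: mult_ac)
    then show "real CARD('n) * real CARD('n) * (32 * \<delta> * M) < \<epsilon>"
      using assms(2) by (simp add: N_def)
  qed
qed

lemma slow_objective:
  fixes \<epsilon> R :: real
  assumes "2 \<le> CARD('n::finite)" "0 < \<epsilon>" "0 < R"
  shows "\<exists>(F :: real^'n \<Rightarrow> real) (x0 :: real^'n).
        smooth F \<and> strongly_convex F \<and>
        smooth_compact_supp (\<lambda>x. F x - std_quad x) \<and>
        supp (\<lambda>x. F x - std_quad x) \<union> {x0} \<subseteq> ball 0 R \<and>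
        bdd_above (range (\<lambda>x. op_norm (hessian F x - mat 1))) \<and>
        (SUP x. op_norm (hessian F x - mat 1)) < \<epsilon> \<and>
        (\<forall>z. minimizer F z \<longleftrightarrow> z = 0) \<and> hessian F 0 = mat 1 \<and>
        (\<exists>x B. bfgs_run F x0 (mat 1) x B) \<and>
        (\<forall>x B. bfgs_run F x0 (mat 1) x B \<longrightarrow>
           curvature_condition F x \<and> (\<forall>k. sym_pos_def (B k)) \<and>
           nonterminating F x \<and> x \<longlonglongrightarrow> 0 \<and>
           q_superlinear x 0 \<and> has_q_order x 0 \<and> q_order x 0 = 1 \<and>
           bfgs_sequence_to F x 0)"
proof -
  obtain \<delta> \<gamma> M and i j :: 'n where obj: "objective \<delta> \<gamma> i j M" and R: "8 * \<gamma> \<le> R"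
    and \<epsilon>: "real CARD('n) * real CARD('n) * (32 * \<delta> * M) < \<epsilon>"
    by (rule ex_objective[OF assms])
  interpret objective \<delta> \<gamma> i j M by (rule obj)
  have F_minus: "(\<lambda>x. F x - std_quad x) = S"
    by (simp add: F_def fun_eq_iff)
  have "norm (X 0) \<le> 2 * \<gamma>"
    using norm_x_bounds(2)[of 0] \<gamma> by (simp add: norm_X g_0)
  then have X_0: "X 0 \<in> ball 0 R" using R \<gamma> by simp
  have supp: "supp S \<subseteq> ball 0 R"
  proof (rule subset_trans[OF supp_S(1)])
    show "cball (0 :: real^'n) (3 * \<gamma>) \<subseteq> ball 0 R" using R \<gamma> by auto
  qed
  have "(SUP x. op_norm (hessian F x - mat 1)) \<le> real CARD('n) * real CARD('n) * (32 * \<delta> * M)"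
    by (rule cSUP_least[OF _ op_norm_hessian]) simp
  then have sup: "(SUP x. op_norm (hessian F x - mat 1)) < \<epsilon>" using \<epsilon> by linarith
  have run: "curvature_condition F x \<and> (\<forall>k. sym_pos_def (B k)) \<and>
           nonterminating F x \<and> x \<longlonglongrightarrow> 0 \<and>
           q_superlinear x 0 \<and> has_q_order x 0 \<and> q_order x 0 = 1 \<and>
           bfgs_sequence_to F x 0" if "bfgs_run F (X 0) (mat 1) x B" for x B
  proof -
    \<comment> \<open>Uniqueness of the run reduces an arbitrary run to the constructed one.\<close>
    have eq: "x = X" "B = H" using that unfolding run_iff by blast+
    have "curvature_condition F X" using curvature by (simp add: curvature_condition_def)
    moreover have "\<forall>k. sym_pos_def (H k)" by (rule allI) (rule H_invariant[THEN conjunct1])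
    moreover have "nonterminating F X"
      using bfgs_sequence_X by (simp add: bfgs_sequence_to_def)
    ultimately show ?thesis
      unfolding eq using X_conv_0 q_superlinear_X q_order_X bfgs_sequence_X
        has_q_order_of_bfgs_sequence(1)[OF bfgs_sequence_X] by (intro conjI)
  qed
  show ?thesis
  proof (intro exI[of _ F] exI[of _ "X 0"] conjI)
    show "smooth_compact_supp (\<lambda>x. F x - std_quad x)"
      unfolding F_minus smooth_compact_supp_def using smooth_S supp_S(2) by simp
    show "supp (\<lambda>x. F x - std_quad x) \<union> {X 0} \<subseteq> ball 0 R"
      unfolding F_minus using supp X_0 by simp
    show "bdd_above (range (\<lambda>x. op_norm (hessian F x - mat 1)))"
      using op_norm_hessian by (rule bdd_aboveI2)
    show "\<forall>z. minimizer F z \<longleftrightarrow> z = 0" by (rule allI) (rule minimizer_F_iff)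
    show "\<exists>x B. bfgs_run F (X 0) (mat 1) x B" using run_iff[of X H] by blast
    show "\<forall>x B. bfgs_run F (X 0) (mat 1) x B \<longrightarrow>
           curvature_condition F x \<and> (\<forall>k. sym_pos_def (B k)) \<and>
           nonterminating F x \<and> x \<longlonglongrightarrow> 0 \<and>
           q_superlinear x 0 \<and> has_q_order x 0 \<and> q_order x 0 = 1 \<and>
           bfgs_sequence_to F x 0"
      by (intro allI impI run)
  qed (rule smooth_F strongly_convex_F sup hessian_F_0)+
qed

theorem theorem1p1:
  shows "(2 \<le> CARD('n::finite) \<longrightarrow>
     (\<forall>\<epsilon>>0. \<forall>R>0. \<exists>(F :: real^'n \<Rightarrow> real) (x0 :: real^'n).
        smooth F \<and> strongly_convex F \<and>
        smooth_compact_supp (\<lambda>x. F x - std_quad x) \<and>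
        supp (\<lambda>x. F x - std_quad x) \<union> {x0} \<subseteq> ball 0 R \<and>
        bdd_above (range (\<lambda>x. op_norm (hessian F x - mat 1))) \<and>
        (SUP x. op_norm (hessian F x - mat 1)) < \<epsilon> \<and>
        (\<forall>z. minimizer F z \<longleftrightarrow> z = 0) \<and> hessian F 0 = mat 1 \<and>
        (\<exists>x B. bfgs_run F x0 (mat 1) x B) \<and>
        (\<forall>x B. bfgs_run F x0 (mat 1) x B \<longrightarrow>
           curvature_condition F x \<and> (\<forall>k. sym_pos_def (B k)) \<and>
           nonterminating F x \<and> x \<longlonglongrightarrow> 0 \<and>
           q_superlinear x 0 \<and> has_q_order x 0 \<and> q_order x 0 = 1 \<and>
           bfgs_sequence_to F x 0))) \<and>
   (\<forall>(F :: real^'n \<Rightarrow> real) x z. bfgs_sequence_to F x z \<longrightarrow>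
      has_q_order x z \<and> 1 \<le> q_order x z) \<and>
   (2 \<le> CARD('n) \<longrightarrow>
      (\<exists>(F :: real^'n \<Rightarrow> real) x z. bfgs_sequence_to F x z \<and> q_order x z = 1))"
proof (intro conjI impI allI, goal_cases)
  case (1 \<epsilon> R)
  then show ?case by (rule slow_objective)
next
  case (2 F x z)
  then show ?case by (rule has_q_order_of_bfgs_sequence)
next
  case (3 F x z)
  then show ?case by (rule has_q_order_of_bfgs_sequence)
next
  case 4
  \<comment> \<open>Attainment does not constrain \<epsilon> and \<open>R\<close>, so both are set
    to 1.\<close>
  obtain \<delta> \<gamma> M and i j :: 'n where "objective \<delta> \<gamma> i j M"
    by (rule ex_objective[OF 4 zero_less_one zero_less_one])
  then interpret objective \<delta> \<gamma> i j M .
  show ?case using bfgs_sequence_X q_order_X by blast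
qed

end
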